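(* Let $\beta>0$ and $\nu\in(0,1)$. The fundamental solution of the generalized (time-fractional) Dodson equation $${}^C\!\left(e^{\beta t}\frac{\partial}{\partial t}\right)^{\nu} c(x,t)=\frac{\partial^2 c}{\partial x^2}(x,t),\qquad x\in\mathbb{R},\ t>0,$$ is given by $$c(x,t)=\frac12\,\mathbb{M}_{\nu/2}\!\left(|x|,\ \frac{1-e^{-\beta t}}{\beta}\right),\qquad x\in\mathbb{R},\ t>0,$$ where, for $0<\alpha<1$, $$M_\alpha(z)=\sum_{n=0}^{\infty}\frac{(-z)^n}{n!\,\Gamma(-\alpha n+1-\alpha)}\quad(z\in\mathbb{C}),\qquad \mathbb{M}_\alpha(y,\lambda)=\frac{1}{\lambda^{\alpha}}\,M_\alpha\!\left(\frac{y}{\lambda^{\alpha}}\right)\quad(y\ge 0,\ \lambda>0).$$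
   Context: For $0<\nu<1$, $\beta>0$, the Caputo-type operator (the Caputo fractional derivative with respect to the function $f$ with $f'(t)=e^{-\beta t}$, with base point $0$) acts on a function $g$ of time $t>0$ by $${}^C\!\left(e^{\beta t}\frac{d}{dt}\right)^{\nu} g(t)=\frac{1}{\Gamma(1-\nu)}\int_0^t\left(\frac{e^{-\beta\tau}-e^{-\beta t}}{\beta}\right)^{-\nu} g'(\tau)\,d\tau ,$$ and on functions $c(x,t)$ it acts in the variable $t$ with $x$ fixed. The convention $1/\Gamma(-j)=0$ for $j=0,1,2,\dots$ is used in the series for $M_\alpha$. "Fundamental solution" means the solution on $\mathbb{R}$ with initial datum $c(x,0)=\delta(x)$ (Dirac delta), the equation being understood through the Fourier transform in $x$: with $\widehat{c}(k,t)=\int_{\mathbb{R}}e^{ikx}c(x,t)\,dx$, for every $k\in\mathbb{R}$ the function $t\mapsto\widehat c(k,t)$ satisfies ${}^C\!\left(e^{\beta t}\frac{\partial}{\partial t}\right)^{\nu}\widehat c(k,t)=-k^2\,\widehat c(k,t)$ for $t>0$ and $\widehat c(k,t)\to 1$ as $t\to0^+$. *)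

theory Defs
  imports "HOL-Analysis.Analysis"
begin

text \<open>
  The function \<open>M\<^sub>\<alpha>\<close>. Here \<^const>\<open>rGamma\<close> is the entire reciprocal Gamma function, so the
  convention \<open>1/\<Gamma>(-j) = 0\<close> is built in. The type of the argument is left generic to cover
  both complex \<open>z\<close> and the real restriction used for the solution.
\<close>

definition wright_M :: "real \<Rightarrow> 'a::real_normed_field \<Rightarrow> 'a" where
  "wright_M \<alpha> z = (\<Sum>n. (rGamma (- \<alpha> * real n + 1 - \<alpha>) / fact n) *\<^sub>R (- z) ^ n)"

definition wright_MM :: "real \<Rightarrow> real \<Rightarrow> real \<Rightarrow> real" where
  "wright_MM \<alpha> y l = 1 / l powr \<alpha> * wright_M \<alpha> (y / l powr \<alpha>)"

definition caputo_dodson_integrand ::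
    "real \<Rightarrow> real \<Rightarrow> (real \<Rightarrow> complex) \<Rightarrow> real \<Rightarrow> real \<Rightarrow> complex" where
  "caputo_dodson_integrand \<beta> \<nu> g t \<tau> =
     ((exp (- \<beta> * \<tau>) - exp (- \<beta> * t)) / \<beta>) powr (- \<nu>) *\<^sub>R vector_derivative g (at \<tau>)"

definition caputo_dodson :: "real \<Rightarrow> real \<Rightarrow> (real \<Rightarrow> complex) \<Rightarrow> real \<Rightarrow> complex" where
  "caputo_dodson \<beta> \<nu> g t =
     (1 / Gamma (1 - \<nu>)) *\<^sub>R (LINT \<tau>:{0<..<t}|lborel. caputo_dodson_integrand \<beta> \<nu> g t \<tau>)"

text \<open>
  \<^const>\<open>vector_derivative\<close> and the Lebesgue integral are total functions, so the
  existence of the derivative and of the integral has to be required separately.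
\<close>

definition caputo_dodson_exists :: "real \<Rightarrow> real \<Rightarrow> (real \<Rightarrow> complex) \<Rightarrow> real \<Rightarrow> bool" where
  "caputo_dodson_exists \<beta> \<nu> g t \<longleftrightarrow>
     (\<forall>\<tau>\<in>{0<..<t}. g differentiable (at \<tau>)) \<and>
     set_integrable lborel {0<..<t} (caputo_dodson_integrand \<beta> \<nu> g t)"

definition fourier_x :: "(real \<Rightarrow> real \<Rightarrow> real) \<Rightarrow> real \<Rightarrow> real \<Rightarrow> complex" where
  "fourier_x c k t =
     (LINT x|lborel. exp (\<i> * complex_of_real k * complex_of_real x) * complex_of_real (c x t))"

text \<open>
  The equation with initial datum \<open>\<delta>\<close>, understood through the Fourier transform in \<open>x\<close>.
  Only values of \<open>c\<close> at times \<open>t > 0\<close> matter.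
\<close>

definition dodson_fundamental_solution ::
    "real \<Rightarrow> real \<Rightarrow> (real \<Rightarrow> real \<Rightarrow> real) \<Rightarrow> bool" where
  "dodson_fundamental_solution \<beta> \<nu> c \<longleftrightarrow>
     (\<forall>t>0. integrable lborel (\<lambda>x. c x t)) \<and>
     (\<forall>k. (\<forall>t>0. caputo_dodson_exists \<beta> \<nu> (fourier_x c k) t \<and>
                   caputo_dodson \<beta> \<nu> (fourier_x c k) t
                     = - (complex_of_real k)\<^sup>2 * fourier_x c k t) \<and>
           (fourier_x c k \<longlongrightarrow> 1) (at_right 0))"

end

theory Submission
  imports Defs "HOL-Probability.Probability" "HOL-Real_Asymp.Real_Asymp"
begin

text \<open>
  On the parabola \<open>\<zeta> = w\<^sup>2\<close>, \<open>w = a + i y\<close>, Hankel's contour integral becomes the Gaussian integral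
  \<open>1/\<Gamma>(s) = (1/\<pi>) \<integral> exp (w\<^sup>2) w\<^bsup>1-2s\<^esup> dy\<close>, valid for all real \<open>s\<close> and \<open>a > 0\<close>.
  Inserted into the series of \<open>M\<close>, it gives
  \<open>M\<^bsub>\<nu>/2\<^esub>(x) = (1/\<pi>) \<integral> exp (w\<^sup>2) w\<^bsup>\<nu>-1\<^esup> exp (- x w\<^sup>\<nu>) dy\<close>, where \<open>Re w\<^sup>\<nu>\<close> is bounded below by a
  positive constant because \<open>\<nu> < 1\<close>. By Fubini the Fourier transform of \<open>c\<close> at \<open>k\<close> is
  \<open>(1/\<pi>) \<integral> exp (w\<^sup>2) w\<^bsup>-1\<^esup> / (1 + k\<^sup>2 s\<^sup>\<nu> w\<^bsup>-2\<nu>\<^esup>) dy\<close> with \<open>s = (1 - exp (- \<beta> t)) / \<beta>\<close>; for \<open>a\<close> large a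
  geometric series turns this into the Mittag-Leffler function \<open>E\<^sub>\<nu>(- k\<^sup>2 s\<^sup>\<nu>)\<close>.
  In the time variable \<open>s\<close> the operator is the ordinary Caputo derivative, and Beta integrals show
  termwise that \<open>E\<^sub>\<nu>(- k\<^sup>2 s\<^sup>\<nu>)\<close> solves the equation.
  For uniqueness, Abel's trick turns the homogeneous equation into a weakly singular Volterra equation
  whose iterates are dominated by the terms of the Mittag-Leffler series, hence vanish; the Fourier
  transform then determines an integrable function almost everywhere, by Levy's uniqueness theorem
  applied to its positive and negative parts.
\<close>

section \<open>Hankel's formula on a parabola\<close>

text \<open>Completing the square turns \<open>exp (C * y - y\<^sup>2)\<close> into a multiple of
  the normal density with mean \<open>C / 2\<close> and variance 1/2; the cases \<open>C = B\<close>
  and \<open>C = - B\<close> together dominate. This is the standard majorant for integrals over a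
  vertical line.\<close>

lemma integrable_exp_abs_minus_square:
  "integrable lborel (\<lambda>y::real. exp (B * \<bar>y\<bar> - y\<^sup>2))"
proof -
  have *: "integrable lborel (\<lambda>y::real. exp (C * y - y\<^sup>2))" for C :: real
  proof -
    have "integrable lborel (\<lambda>x. normal_density (C / 2) (1 / sqrt 2) x)"
      by (rule integrable_normal_density) auto
    hence "integrable lborel (\<lambda>y. (sqrt pi * exp (C\<^sup>2 / 4)) * normal_density (C / 2) (1 / sqrt 2) y)"
      by simp
    also have "(\<lambda>y. (sqrt pi * exp (C\<^sup>2 / 4)) * normal_density (C / 2) (1 / sqrt 2) y)
       = (\<lambda>y. exp (C * y - y\<^sup>2))"
      by (auto simp: normal_density_def power_divide real_sqrt_divide fun_eq_iff power2_eq_square 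
          field_simps simp flip: exp_add)
    finally show ?thesis .
  qed
  show ?thesis
    by (rule Bochner_Integration.integrable_bound[OF Bochner_Integration.integrable_add[OF *[of B] *[of "-B"]]])
      (auto simp: abs_of_pos[OF add_pos_pos[OF exp_gt_zero exp_gt_zero]] split: abs_split intro!: AE_I2)
qed

text \<open>A product majorant gives the hypothesis of Fubini's theorem; it serves the shift of the
  line and the Fourier transform.\<close>

lemma integrable_lborel_pair_bound:
  fixes f :: "real \<times> real \<Rightarrow> complex"
  assumes f: "f \<in> borel_measurable borel"
    and g: "integrable lborel g" and h: "integrable lborel h"
    and le: "\<And>x y. norm (f (x, y)) \<le> g x * h y"
  shows "integrable (lborel \<Otimes>\<^sub>M lborel) f"
proof (rule Bochner_Integration.integrable_bound[where f = "\<lambda>p. g (fst p) * h (snd p)"])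
  have [measurable]: "g \<in> borel_measurable borel" "h \<in> borel_measurable borel"
    using g h by (auto dest: borel_measurable_integrable)
  show "integrable (lborel \<Otimes>\<^sub>M lborel) (\<lambda>p. g (fst p) * h (snd p))"
  proof (rule lborel_pair.Fubini_integrable)
    show "integrable lborel (\<lambda>x. LINT y|lborel. norm (g (fst (x,y)) * h (snd (x,y))))"
      using g by (simp add: abs_mult)
  qed (use h in auto)
  show "AE p in lborel \<Otimes>\<^sub>M lborel. norm (f p) \<le> norm (g (fst p) * h (snd p))"
    using le by (auto intro!: AE_I2 order_trans[OF _ abs_ge_self])
qed (use f in \<open>simp add: lborel_prod\<close>)

lemma integral_real_line_FTC_zero:
  fixes F :: "real \<Rightarrow> 'a::euclidean_space"
  assumes F: "\<And>x. (F has_vector_derivative f x) (at x)"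
    and f: "continuous_on UNIV f" "integrable lborel f"
    and lim: "(F \<longlongrightarrow> 0) at_top" "(F \<longlongrightarrow> 0) at_bot"
  shows "(LINT x|lborel. f x) = 0"
proof -
  have "(LBINT x=-\<infinity>..\<infinity>. f x) = 0 - 0"
  proof (rule interval_integral_FTC_integrable)
    show "set_integrable lborel (einterval (- \<infinity>) \<infinity>) f"
      using f(2) by (simp add: set_integrable_def)
    show "((F \<circ> real_of_ereal) \<longlongrightarrow> 0) (at_right (-\<infinity>))"
      using lim(2) by (simp add: ereal_tendsto_simps)
    show "((F \<circ> real_of_ereal) \<longlongrightarrow> 0) (at_left \<infinity>)"
      using lim(1) by (simp add: ereal_tendsto_simps)
  qed (use F f(1) in \<open>auto simp: continuous_on_eq_continuous_at\<close>)
  thus ?thesis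
    by (simp add: interval_lebesgue_integral_def set_lebesgue_integral_def)
qed

section \<open>The Hankel integrand and its size\<close>

text \<open>The integrand of Hankel's formula for 1/Gamma(s), with \<open>b\<close> in the place of
  1 - 2s. The power is the principal one, which is holomorphic on the right half-plane.\<close>

definition hankel_kernel :: "real \<Rightarrow> real \<Rightarrow> real \<Rightarrow> complex" where
  "hankel_kernel b a y = exp ((Complex a y)\<^sup>2) * Complex a y powr of_real b"

lemma norm_exp_Complex_square: "norm (exp ((Complex a y)\<^sup>2)) = exp (a\<^sup>2 - y\<^sup>2)"
  by (simp add: norm_exp_eq_Re power2_eq_square)

lemma norm_Complex_bounds:
  assumes "a \<ge> 0"
  shows "a \<le> norm (Complex a y)" "norm (Complex a y) \<le> a + \<bar>y\<bar>"
  using assms complex_Re_le_cmod[of "Complex a y"] cmod_le[of "Complex a y"] by auto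

lemma norm_Complex_powr_le:
  assumes "b \<ge> 0" "0 \<le> a"
  shows "norm (Complex a y powr of_real b) \<le> exp (b * (a + \<bar>y\<bar>))"
proof -
  have "norm (Complex a y) \<le> exp (a + \<bar>y\<bar>)"
    using norm_Complex_bounds(2)[OF assms(2), of y] exp_ge_add_one_self[of "a + \<bar>y\<bar>"] by linarith
  hence "norm (Complex a y) powr b \<le> exp (a + \<bar>y\<bar>) powr b"
    using assms by (intro powr_mono2) auto
  thus ?thesis by (simp add: norm_powr_real_powr' exp_powr_real mult_ac)
qed

lemma norm_Complex_powr_le':
  assumes "b \<le> 0" "0 < a"
  shows "norm (Complex a y powr of_real b) \<le> a powr b"
  using assms norm_Complex_bounds(1)[of a y] by (simp add: norm_powr_real_powr' powr_mono2')

text \<open>The two summands of the constant cover the two signs of \<open>b\<close>: a negative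
  power is largest where the modulus is least, a nonnegative one is controlled by an exponential.
  Uniformity for \<open>a\<close> between \<open>a1\<close> and \<open>a2\<close> allows integration
  over a strip.\<close>

lemma norm_hankel_kernel_le:
  assumes "0 < a1" "a1 \<le> a" "a \<le> a2"
  shows "norm (hankel_kernel b a y) \<le> exp (a2\<^sup>2) * (a1 powr b + exp (\<bar>b\<bar> * a2)) * exp (\<bar>b\<bar> * \<bar>y\<bar> - y\<^sup>2)"
proof -
  have *: "norm (Complex a y powr of_real b) \<le> (a1 powr b + exp (\<bar>b\<bar> * a2)) * exp (\<bar>b\<bar> * \<bar>y\<bar>)"
  proof (cases "b \<ge> 0")
    case True
    have "norm (Complex a y powr of_real b) \<le> exp (b * (a + \<bar>y\<bar>))"
      using norm_Complex_powr_le[OF True] assms by auto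
    also have "\<dots> \<le> exp (b * (a2 + \<bar>y\<bar>))" using assms True by (simp add: mult_left_mono)
    also have "\<dots> = exp (\<bar>b\<bar> * a2) * exp (\<bar>b\<bar> * \<bar>y\<bar>)" using True by (simp add: exp_add[symmetric] algebra_simps)
    also have "\<dots> \<le> (a1 powr b + exp (\<bar>b\<bar> * a2)) * exp (\<bar>b\<bar> * \<bar>y\<bar>)" by (intro mult_right_mono) auto
    finally show ?thesis .
  next
    case False
    have "norm (Complex a y powr of_real b) \<le> a powr b"
      using norm_Complex_powr_le'[of b a y] assms False by auto
    also have "\<dots> \<le> a1 powr b" using assms False by (intro powr_mono2') auto
    also have "\<dots> \<le> (a1 powr b + exp (\<bar>b\<bar> * a2)) * 1" by simp
    also have "\<dots> \<le> (a1 powr b + exp (\<bar>b\<bar> * a2)) * exp (\<bar>b\<bar> * \<bar>y\<bar>)"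
      by (intro mult_left_mono add_nonneg_nonneg) auto
    finally show ?thesis .
  qed
  have "norm (hankel_kernel b a y) = exp (a\<^sup>2 - y\<^sup>2) * norm (Complex a y powr of_real b)"
    unfolding hankel_kernel_def norm_mult norm_exp_Complex_square ..
  also have "\<dots> \<le> exp (a2\<^sup>2 - y\<^sup>2) * ((a1 powr b + exp (\<bar>b\<bar> * a2)) * exp (\<bar>b\<bar> * \<bar>y\<bar>))"
    using assms by (intro mult_mono *) (auto intro!: power_mono)
  also have "\<dots> = exp (a2\<^sup>2) * (a1 powr b + exp (\<bar>b\<bar> * a2)) * exp (\<bar>b\<bar> * \<bar>y\<bar> - y\<^sup>2)"
    by (simp add: exp_diff field_simps)
  finally show ?thesis .
qed

lemma Complex_Re_pos_not_nonpos_Reals: "a > 0 \<Longrightarrow> Complex a y \<notin> \<real>\<^sub>\<le>\<^sub>0"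
  by (auto simp: complex_nonpos_Reals_iff)

lemma Complex_conv: "Complex x y = of_real x + \<i> * of_real y"
  by (simp add: complex_eq_iff)

text \<open>A positive real part keeps the base of the power off the branch cut. With both
  coordinates as functions, one statement covers continuity in \<open>y\<close>, in \<open>a\<close>
  and jointly.\<close>

lemma continuous_on_hankel_kernel:
  assumes "continuous_on S f" "continuous_on S g" "\<And>x. x \<in> S \<Longrightarrow> f x > 0"
  shows "continuous_on S (\<lambda>x. hankel_kernel b (f x) (g x))"
proof -
  have "f x + \<i> * g x \<notin> \<real>\<^sub>\<le>\<^sub>0" if "x \<in> S" for x
    using Complex_Re_pos_not_nonpos_Reals[OF assms(3)[OF that]] by (simp add: Complex_conv)
  thus ?thesis unfolding hankel_kernel_def Complex_conv
    by (intro continuous_intros assms(1,2)) (use assms(3) in \<open>force simp: complex_eq_iff\<close>)+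
qed

lemma integrable_hankel_kernel:
  assumes "a > 0"
  shows "integrable lborel (hankel_kernel b a)"
proof (rule Bochner_Integration.integrable_bound)
  show "integrable lborel (\<lambda>y. exp (a\<^sup>2) * (a powr b + exp (\<bar>b\<bar> * a)) * exp (\<bar>b\<bar> * \<bar>y\<bar> - y\<^sup>2))"
    by (intro integrable_mult_right integrable_exp_abs_minus_square)
  show "hankel_kernel b a \<in> borel_measurable lborel"
    using continuous_on_hankel_kernel[of UNIV "\<lambda>_. a" "\<lambda>y. y"] assms
    by (auto intro!: borel_measurable_continuous_onI)
qed (use norm_hankel_kernel_le[of a a a] assms in \<open>auto simp: add_nonneg_nonneg abs_mult\<close>)

section \<open>Recurrence in the exponent and shift of the line\<close>

text \<open>The derivative of \<open>exp (w\<^sup>2) w\<^sup>b\<close> at \<open>w = a + i y\<close>. Its integral over \<open>y\<close> vanishes, which yields both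
  the independence of \<open>a\<close> and the recurrence in \<open>b\<close>.\<close>

definition hankel_deriv :: "real \<Rightarrow> real \<Rightarrow> real \<Rightarrow> complex" where
  "hankel_deriv b a y = 2 * hankel_kernel (b + 1) a y + of_real b * hankel_kernel (b - 1) a y"

lemma hankel_deriv_complex:
  assumes "a > 0"
  shows "((\<lambda>w. exp (w\<^sup>2) * w powr of_real b) has_field_derivative hankel_deriv b a y) (at (Complex a y))"
  using Complex_Re_pos_not_nonpos_Reals[OF assms, of y] assms
  by (auto intro!: derivative_eq_intros simp: hankel_deriv_def hankel_kernel_def powr_add algebra_simps Complex_eq_0)

lemma hankel_kernel_deriv_Im:
  assumes "a > 0"
  shows "(hankel_kernel b a has_vector_derivative \<i> * hankel_deriv b a y) (at y)"
proof -
  have "((\<lambda>y. Complex a y) has_vector_derivative \<i>) (at y)"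
    unfolding Complex_conv by (auto intro!: derivative_eq_intros)
  from field_vector_diff_chain_at[OF this hankel_deriv_complex[OF assms]]
  show ?thesis by (simp add: o_def hankel_kernel_def[abs_def])
qed

text \<open>Compared with the vertical derivative only the factor \<open>\<i>\<close> is missing,
  which is the Cauchy-Riemann relation. So the vanishing of one integral over \<open>y\<close>
  serves both directions.\<close>

lemma hankel_kernel_deriv_Re:
  assumes "a > 0"
  shows "((\<lambda>a. hankel_kernel b a y) has_vector_derivative hankel_deriv b a y) (at a)"
proof -
  have "((\<lambda>a. Complex a y) has_vector_derivative 1) (at a)"
    unfolding Complex_conv by (auto intro!: derivative_eq_intros)
  from field_vector_diff_chain_at[OF this hankel_deriv_complex[OF assms]]
  show ?thesis by (simp add: o_def hankel_kernel_def[abs_def])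
qed

lemma integrable_hankel_deriv: "a > 0 \<Longrightarrow> integrable lborel (hankel_deriv b a)"
  unfolding hankel_deriv_def[abs_def]
  by (intro Bochner_Integration.integrable_add integrable_mult_right integrable_hankel_kernel)

text \<open>Up to the factor \<open>\<i>\<close> the integrand is the derivative of
  \<open>hankel_kernel b a\<close>, which the Gaussian factor sends to 0 at both ends of the
  line.\<close>

lemma integral_hankel_deriv:
  assumes "a > 0"
  shows "(LINT y|lborel. hankel_deriv b a y) = 0"
proof -
  \<comment> \<open>An arbitrary filter along which the absolute value tends to infinity treats both
    ends at once.\<close>
  have lim: "(hankel_kernel b a \<longlongrightarrow> 0) F" if "filterlim (\<lambda>y::real. \<bar>y\<bar>) at_top F" for F
  proof (rule Lim_null_comparison)
    show "\<forall>\<^sub>F y in F. norm (hankel_kernel b a y) \<le> exp (a\<^sup>2) * (a powr b + exp (\<bar>b\<bar> * a)) * exp (\<bar>b\<bar> * \<bar>y\<bar> - \<bar>y\<bar>\<^sup>2)"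
      using norm_hankel_kernel_le[of a a a] assms by auto
    have "((\<lambda>y. exp (\<bar>b\<bar> * y - y\<^sup>2)) \<longlongrightarrow> 0) at_top" by real_asymp
    from tendsto_mult_right_zero[OF filterlim_compose[OF this that]]
    show "((\<lambda>y. exp (a\<^sup>2) * (a powr b + exp (\<bar>b\<bar> * a)) * exp (\<bar>b\<bar> * \<bar>y\<bar> - \<bar>y\<bar>\<^sup>2)) \<longlongrightarrow> 0) F" .
  qed
  have "(LINT y|lborel. \<i> * hankel_deriv b a y) = 0"
  proof (rule integral_real_line_FTC_zero)
    show "(hankel_kernel b a has_vector_derivative \<i> * hankel_deriv b a x) (at x)" for x
      by (rule hankel_kernel_deriv_Im[OF assms])
    show "continuous_on UNIV (\<lambda>y. \<i> * hankel_deriv b a y)"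
      unfolding hankel_deriv_def using assms by (intro continuous_intros continuous_on_hankel_kernel) auto
    show "integrable lborel (\<lambda>y. \<i> * hankel_deriv b a y)"
      using integrable_hankel_deriv[OF assms] by simp
    show "(hankel_kernel b a \<longlongrightarrow> 0) at_top" by (rule lim) real_asymp
    show "(hankel_kernel b a \<longlongrightarrow> 0) at_bot" by (rule lim) real_asymp
  qed
  thus ?thesis by simp
qed

text \<open>Integration by parts; under Hankel's formula it corresponds to the functional equation z
  rGamma(z + 1) = rGamma(z) at z = - b / 2.\<close>

lemma integral_hankel_kernel_rec:
  assumes "a > 0"
  shows "2 * (LINT y|lborel. hankel_kernel (b + 1) a y) = - of_real b * (LINT y|lborel. hankel_kernel (b - 1) a y)"
proof -
  have "(LINT y|lborel. hankel_deriv b a y) =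
      2 * (LINT y|lborel. hankel_kernel (b + 1) a y) + of_real b * (LINT y|lborel. hankel_kernel (b - 1) a y)"
    unfolding hankel_deriv_def using integrable_hankel_kernel[OF assms]
    by (subst Bochner_Integration.integral_add) auto
  thus ?thesis using integral_hankel_deriv[OF assms] by (simp add: eq_neg_iff_add_eq_0)
qed

text \<open>Cauchy's theorem on a strip, by Fubini: integrating the horizontal derivative first
  across the strip gives the difference of the two kernels, integrating it first along the vertical
  lines gives 0.\<close>

lemma integral_hankel_kernel_shift:
  assumes "0 < a1" "a1 \<le> a2"
  shows "(LINT y|lborel. hankel_kernel b a1 y) = (LINT y|lborel. hankel_kernel b a2 y)"
proof -
  define f where "f = (\<lambda>p. indicator ({a1..a2} \<times> UNIV) p *\<^sub>R hankel_deriv b (fst p) (snd p))"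
  \<comment> \<open>Large enough for both exponents \<open>b + 1\<close> and \<open>b - 1\<close>
    that occur in \<open>hankel_deriv\<close>.\<close>
  define B where "B = \<bar>b\<bar> + 1"
  obtain K where K: "\<And>x y. a1 \<le> x \<Longrightarrow> x \<le> a2 \<Longrightarrow> norm (hankel_deriv b x y) \<le> K * exp (B * \<bar>y\<bar> - y\<^sup>2)" "K \<ge> 0"
  proof
    let ?C = "\<lambda>b. exp (a2\<^sup>2) * (a1 powr b + exp (\<bar>b\<bar> * a2))"
    let ?K = "2 * ?C (b + 1) + \<bar>b\<bar> * ?C (b - 1)"
    show "?K \<ge> 0" by (intro add_nonneg_nonneg mult_nonneg_nonneg) auto
    fix x y assume x: "a1 \<le> x" "x \<le> a2"
    have *: "norm (hankel_kernel c x y) \<le> ?C c * exp (B * \<bar>y\<bar> - y\<^sup>2)" if "\<bar>c\<bar> \<le> B" for c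
    proof -
      have "norm (hankel_kernel c x y) \<le> ?C c * exp (\<bar>c\<bar> * \<bar>y\<bar> - y\<^sup>2)"
        by (rule norm_hankel_kernel_le) (use x assms in auto)
      also have "\<dots> \<le> ?C c * exp (B * \<bar>y\<bar> - y\<^sup>2)"
        using that by (intro mult_left_mono) (auto intro!: mult_right_mono add_nonneg_nonneg)
      finally show ?thesis .
    qed
    have "norm (hankel_deriv b x y) \<le> 2 * norm (hankel_kernel (b+1) x y) + \<bar>b\<bar> * norm (hankel_kernel (b-1) x y)"
      unfolding hankel_deriv_def by (rule order_trans[OF norm_triangle_ineq]) (simp add: norm_mult)
    also have "\<dots> \<le> 2 * (?C (b+1) * exp (B * \<bar>y\<bar> - y\<^sup>2)) + \<bar>b\<bar> * (?C (b-1) * exp (B * \<bar>y\<bar> - y\<^sup>2))"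
      by (intro add_mono mult_left_mono *) (auto simp: B_def)
    finally show "norm (hankel_deriv b x y) \<le> ?K * exp (B * \<bar>y\<bar> - y\<^sup>2)" by (simp add: algebra_simps)
  qed
  have "integrable (lborel \<Otimes>\<^sub>M lborel) f"
  proof (rule integrable_lborel_pair_bound)
    show "f \<in> borel_measurable borel" unfolding f_def hankel_deriv_def
    proof (rule borel_measurable_continuous_on_indicator)
      show "{a1..a2} \<times> (UNIV :: real set) \<in> sets borel"
        by (intro borel_closed closed_Times) auto
    qed (use assms in \<open>auto intro!: continuous_intros continuous_on_hankel_kernel\<close>)
    show "integrable lborel (\<lambda>x. indicator {a1..a2} x * K)"
      by (simp add: integrable_real_indicator emeasure_lborel_Icc_eq)
    show "norm (f (x, y)) \<le> (indicator {a1..a2} x * K) * exp (B * \<bar>y\<bar> - y\<^sup>2)" for x y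
      using K by (auto simp: f_def indicator_def)
  qed (rule integrable_exp_abs_minus_square)
  hence int: "integrable (lborel \<Otimes>\<^sub>M lborel) (case_prod (\<lambda>x y. f (x, y)))" by simp
  have inner: "(LINT x|lborel. f (x, y)) = hankel_kernel b a2 y - hankel_kernel b a1 y" for y
  proof -
    have "(LINT x|lborel. indicator {a1..a2} x *\<^sub>R hankel_deriv b x y) = hankel_kernel b a2 y - hankel_kernel b a1 y"
    proof (rule integral_FTC_Icc)
      show "((\<lambda>a. hankel_kernel b a y) has_vector_derivative hankel_deriv b x y) (at x within {a1..a2})"
        if "a1 \<le> x" "x \<le> a2" for x
        by (rule has_vector_derivative_at_within, rule hankel_kernel_deriv_Re) (use that assms in auto)
      show "continuous_on {a1..a2} (\<lambda>x. hankel_deriv b x y)"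
        unfolding hankel_deriv_def using assms by (intro continuous_intros continuous_on_hankel_kernel) auto
    qed (use assms in auto)
    thus ?thesis by (simp add: f_def indicator_times)
  qed
  have outer: "(LINT y|lborel. f (x, y)) = 0" for x
    using integral_hankel_deriv[of x b] assms by (cases "x \<in> {a1..a2}") (auto simp: f_def indicator_times)
  have "(LINT y|lborel. hankel_kernel b a2 y - hankel_kernel b a1 y) = 0"
    using lborel_pair.Fubini_integral[OF int] by (simp add: inner outer)
  thus ?thesis using integrable_hankel_kernel assms
    by (subst (asm) Bochner_Integration.integral_diff) auto
qed

section \<open>Evaluation on the imaginary axis\<close>

text \<open>The substitution t = y^2 in Euler's integral for Gamma gives twice the integral over the
  half-line, and evenness of the integrand makes that the whole line.\<close>

lemma has_bochner_integral_abs_powr_gauss: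
  assumes "b > -1"
  shows "has_bochner_integral lborel (\<lambda>y::real. \<bar>y\<bar> powr b * exp (- y\<^sup>2)) (Gamma ((b + 1) / 2))"
proof -
  define x where "x = (b + 1) / 2"
  have x: "x > 0" using assms by (simp add: x_def)
  let ?f = "\<lambda>t. t powr (x - 1) / exp t"
  let ?h = "\<lambda>y::real. \<bar>2 * y\<bar> * ?f (y\<^sup>2)"
  have img: "(\<lambda>y::real. y\<^sup>2) ` {0..} = {0..}"
  proof (intro equalityI subsetI)
    fix t :: real assume "t \<in> {0..}"
    thus "t \<in> (\<lambda>y::real. y\<^sup>2) ` {0..}" by (intro image_eqI[of _ _ "sqrt t"]) auto
  qed auto
  have "?f absolutely_integrable_on {0..}"
    using Gamma_integral_real[OF x] by (intro nonnegative_absolutely_integrable_1) (auto simp: has_integral_integrable)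
  hence "?f absolutely_integrable_on (\<lambda>y::real. y\<^sup>2) ` {0..} \<and> integral ((\<lambda>y::real. y\<^sup>2) ` {0..}) ?f = Gamma x"
    using Gamma_integral_real[OF x] by (simp add: img integral_unique)
  hence h: "?h absolutely_integrable_on {0..}" "integral {0..} ?h = Gamma x"
    by (subst (asm) has_absolute_integral_change_of_variables_1'[symmetric, where g' = "\<lambda>y. 2 * y"];
        force intro!: derivative_eq_intros inj_onI simp: power2_eq_iff_nonneg)+
  have eq: "?h y = 2 * (\<bar>y\<bar> powr b * exp (- y\<^sup>2))" if "y \<noteq> 0" for y
  proof -
    have "b = 1 + 2 * (x - 1)" by (simp add: x_def field_simps)
    hence "\<bar>y\<bar> powr b = \<bar>y\<bar> powr (1 + 2 * (x - 1))" by simp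
    also have "\<dots> = \<bar>y\<bar> * (y\<^sup>2) powr (x - 1)"
      using that powr_powr[of "\<bar>y\<bar>" 2 "x - 1"] by (simp only: powr_add powr_numeral) (simp add: powr_one)
    finally show ?thesis by (simp add: exp_minus abs_mult field_simps)
  qed
  have hl: "set_integrable lborel {0..} ?h"
    using h(1) unfolding set_integrable_def by (subst (asm) integrable_completion) auto
  have "(LINT y:{0..}|lborel. ?h y) = Gamma x"
    using set_borel_integral_eq_integral(2)[OF hl] h(2) by simp
  hence "has_bochner_integral lborel (\<lambda>y. indicator {0..} y *\<^sub>R ?h y) (Gamma x)"
    using hl by (simp add: has_bochner_integral_iff set_integrable_def set_lebesgue_integral_def)
  hence "has_bochner_integral lborel (\<lambda>y. indicator {0..} y *\<^sub>R (2 * (\<bar>y\<bar> powr b * exp (- y\<^sup>2)))) (Gamma x)"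
  proof (rule has_bochner_integral_cong_AE[THEN iffD1, rotated -1])
    show "AE y in lborel. indicator {0..} y *\<^sub>R ?h y = indicator {0..} y *\<^sub>R (2 * (\<bar>y\<bar> powr b * exp (- y\<^sup>2)))"
      using AE_lborel_singleton[of "0::real"] by eventually_elim (simp only: eq not_False_eq_True)
  qed auto
  from has_bochner_integral_even_function[OF this]
  have "has_bochner_integral lborel (\<lambda>y. 2 * (\<bar>y\<bar> powr b * exp (- y\<^sup>2))) (2 * Gamma x)" by simp
  from has_bochner_integral_mult_right[OF this, of "1/2"] show ?thesis by (simp add: x_def)
qed

text \<open>The number is a positive multiple of \<open>\<i>\<close> or of \<open>- \<i>\<close>,
  and a positive factor leaves the principal logarithm without a branch correction.\<close>

lemma Ln_imaginary:
  assumes "y \<noteq> 0"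
  shows "Ln (Complex 0 y) = Complex (ln \<bar>y\<bar>) (sgn y * pi / 2)"
proof (cases "y > 0")
  case True
  have "Ln (of_real y * \<i>) = of_real (ln y) + Ln \<i>"
    using Ln_times_of_real[of y \<i>] True by (simp add: Ln_of_real)
  moreover have "of_real y * \<i> = Complex 0 y" by (simp add: complex_eq_iff)
  ultimately show ?thesis using True by (simp add: complex_eq_iff)
next
  case False
  have "Ln (of_real (-y) * (-\<i>)) = of_real (ln (-y)) + Ln (-\<i>)"
    using Ln_times_of_real[of "-y" "-\<i>"] False assms by (simp add: Ln_of_real del: of_real_minus)
  moreover have "of_real (-y) * (-\<i>) = Complex 0 y" by (simp add: complex_eq_iff)
  ultimately have "Ln (Complex 0 y) = of_real (ln (-y)) + Ln (-\<i>)" by (simp only:)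
  thus ?thesis using False assms by (simp add: complex_eq_iff)
qed

text \<open>On the imaginary axis the power has argument plus or minus pi b / 2, so the kernel
  splits into an even cosine part and an odd sine part; only the even part survives
  integration.\<close>

lemma hankel_kernel_0:
  assumes "y \<noteq> 0"
  shows "hankel_kernel b 0 y =
     of_real (cos (pi * b / 2) * (\<bar>y\<bar> powr b * exp (-y\<^sup>2)))
      + \<i> * of_real (sin (pi * b / 2)) * of_real (sgn y * (\<bar>y\<bar> powr b * exp (-y\<^sup>2)))"
proof -
  have nz: "Complex 0 y \<noteq> 0" using assms by (simp add: complex_eq_iff)
  have 1: "exp ((Complex 0 y)\<^sup>2) = of_real (exp (-y\<^sup>2))"
    by (simp add: complex_eq_iff exp_of_real[symmetric] Complex_conv power_mult_distrib)
  have "Complex 0 y powr of_real b = exp (of_real (b * ln \<bar>y\<bar>) + \<i> * of_real (b * sgn y * pi / 2))"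
    using nz Ln_imaginary[OF assms] by (simp add: powr_def Complex_conv algebra_simps)
  also have "\<dots> = of_real (\<bar>y\<bar> powr b) * cis (sgn y * (pi * b / 2))"
    using assms by (simp add: exp_add exp_of_real[symmetric] powr_def cis_conv_exp mult_ac)
  also have "cis (sgn y * (pi * b / 2)) = of_real (cos (pi * b / 2)) + \<i> * of_real (sgn y * sin (pi * b / 2))"
    using assms by (cases "y > 0") (auto simp: complex_eq_iff)
  finally show ?thesis unfolding hankel_kernel_def 1 by (simp add: algebra_simps)
qed

text \<open>For \<open>b \<ge> 0\<close> the line of integration can be moved to \<open>a = 0\<close>.\<close>

lemma integral_hankel_kernel_nonneg:
  assumes a: "a > 0" and b: "b \<ge> 0"
  shows "(LINT y|lborel. hankel_kernel b a y) = of_real (cos (pi * b / 2) * Gamma ((b + 1) / 2))"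
proof -
  have shift: "(LINT y|lborel. hankel_kernel b x y) = (LINT y|lborel. hankel_kernel b a y)" if "x > 0" for x
    using integral_hankel_kernel_shift[of x a b] integral_hankel_kernel_shift[of a x b, symmetric] that a
    by linarith
  define A where "A = (\<lambda>n::nat. 1 / real (Suc n))"
  have A: "A n > 0" "A n \<le> 1" "A \<longlonglongrightarrow> 0" for n
    using LIMSEQ_inverse_real_of_nat unfolding A_def by (auto simp: field_simps)
  \<comment> \<open>On the axis the real part is no longer positive, so measurability is read off
    the explicit formula, with the value at 0 patched in.\<close>
  have m0: "hankel_kernel b 0 \<in> borel_measurable lborel"
  proof -
    have "(\<lambda>y. if y = 0 then hankel_kernel b 0 0 else of_real (cos (pi * b / 2) * (\<bar>y\<bar> powr b * exp (-y\<^sup>2)))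
      + \<i> * of_real (sin (pi * b / 2)) * of_real (sgn y * (\<bar>y\<bar> powr b * exp (-y\<^sup>2)))) \<in> borel_measurable lborel"
      unfolding sgn_real_def by measurable
    also have "(\<lambda>y. if y = 0 then hankel_kernel b 0 0 else of_real (cos (pi * b / 2) * (\<bar>y\<bar> powr b * exp (-y\<^sup>2)))
      + \<i> * of_real (sin (pi * b / 2)) * of_real (sgn y * (\<bar>y\<bar> powr b * exp (-y\<^sup>2)))) = hankel_kernel b 0"
      by (auto simp: fun_eq_iff hankel_kernel_0)
    finally show ?thesis .
  qed
  have "(\<lambda>n. LINT y|lborel. hankel_kernel b (A n) y) \<longlonglongrightarrow> (LINT y|lborel. hankel_kernel b 0 y)"
  proof (rule integral_dominated_convergence)
    \<comment> \<open>The majorant is uniform as the lines approach the branch point 0 because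
      \<open>b \<ge> 0\<close> keeps the power bounded there.\<close>
    show "integrable lborel (\<lambda>y. exp (1 + b) * exp (b * \<bar>y\<bar> - y\<^sup>2))"
      by (intro integrable_mult_right integrable_exp_abs_minus_square)
    show "hankel_kernel b (A n) \<in> borel_measurable lborel" for n
      using integrable_hankel_kernel[OF A(1)] by (rule borel_measurable_integrable)
    show "AE y in lborel. norm (hankel_kernel b (A n) y) \<le> exp (1 + b) * exp (b * \<bar>y\<bar> - y\<^sup>2)" for n
    proof (rule AE_I2)
      fix y
      have "norm (hankel_kernel b (A n) y) \<le> exp ((A n)\<^sup>2 - y\<^sup>2) * exp (b * (A n + \<bar>y\<bar>))"
        unfolding hankel_kernel_def norm_mult norm_exp_Complex_square
        using norm_Complex_powr_le[OF b, of "A n" y] A(1)[of n] by (intro mult_left_mono) auto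
      also have "\<dots> = exp ((A n)\<^sup>2 + b * A n) * exp (b * \<bar>y\<bar> - y\<^sup>2)"
        by (simp add: exp_add[symmetric] algebra_simps)
      also have "(A n)\<^sup>2 + b * A n \<le> 1 + b * 1"
        using A(1,2)[of n] b by (intro add_mono mult_left_mono) (auto simp: power_le_one)
      finally show "norm (hankel_kernel b (A n) y) \<le> exp (1 + b) * exp (b * \<bar>y\<bar> - y\<^sup>2)"
        by (simp add: mult_right_mono)
    qed
    show "AE y in lborel. (\<lambda>n. hankel_kernel b (A n) y) \<longlonglongrightarrow> hankel_kernel b 0 y"
      using AE_lborel_singleton[of "0::real"]
    proof eventually_elim
      case (elim y)
      have "Complex 0 y \<notin> \<real>\<^sub>\<le>\<^sub>0" using elim by (simp add: complex_nonpos_Reals_iff)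
      moreover have "(\<lambda>n. Complex (A n) y) \<longlonglongrightarrow> Complex 0 y" by (intro tendsto_intros A)
      ultimately show ?case unfolding hankel_kernel_def
        by (intro tendsto_mult tendsto_exp tendsto_power tendsto_powr_complex tendsto_const)
    qed
  qed (use m0 in auto)
  hence *: "(LINT y|lborel. hankel_kernel b a y) = (LINT y|lborel. hankel_kernel b 0 y)"
    using shift[OF A(1)] by (simp add: LIMSEQ_const_iff)
  have G: "has_bochner_integral lborel (\<lambda>y::real. \<bar>y\<bar> powr b * exp (- y\<^sup>2)) (Gamma ((b + 1) / 2))"
    using b by (intro has_bochner_integral_abs_powr_gauss) auto
  have O: "has_bochner_integral lborel (\<lambda>y::real. sgn y * (\<bar>y\<bar> powr b * exp (- y\<^sup>2))) 0"
  proof (rule has_bochner_integral_odd_function)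
    have "integrable lborel (\<lambda>y. indicator {0..} y *\<^sub>R (sgn y * (\<bar>y\<bar> powr b * exp (- y\<^sup>2))))"
      by (rule Bochner_Integration.integrable_bound[OF integrable.intros[OF G]])
         (auto simp: sgn_real_def indicator_def)
    thus "has_bochner_integral lborel (\<lambda>y. indicator {0..} y *\<^sub>R (sgn y * (\<bar>y\<bar> powr b * exp (- y\<^sup>2))))
      (LINT y|lborel. indicator {0..} y *\<^sub>R (sgn y * (\<bar>y\<bar> powr b * exp (- y\<^sup>2))))"
      by (rule has_bochner_integral_integrable)
  qed (auto simp: sgn_minus)
  have "has_bochner_integral lborel (\<lambda>y. of_real (cos (pi * b / 2) * (\<bar>y\<bar> powr b * exp (-y\<^sup>2)))
      + \<i> * of_real (sin (pi * b / 2)) * of_real (sgn y * (\<bar>y\<bar> powr b * exp (-y\<^sup>2))))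
      (of_real (cos (pi * b / 2) * Gamma ((b + 1) / 2)) + \<i> * of_real (sin (pi * b / 2)) * of_real 0)"
    by (intro has_bochner_integral_add has_bochner_integral_mult_right has_bochner_integral_of_real G O)
  moreover have "AE y in lborel. hankel_kernel b 0 y = of_real (cos (pi * b / 2) * (\<bar>y\<bar> powr b * exp (-y\<^sup>2)))
      + \<i> * of_real (sin (pi * b / 2)) * of_real (sgn y * (\<bar>y\<bar> powr b * exp (-y\<^sup>2)))"
    using AE_lborel_singleton[of "0::real"] by eventually_elim (rule hankel_kernel_0)
  moreover from this have "(LINT y|lborel. hankel_kernel b 0 y) = (LINT y|lborel. of_real (cos (pi * b / 2) * (\<bar>y\<bar> powr b * exp (-y\<^sup>2)))
      + \<i> * of_real (sin (pi * b / 2)) * of_real (sgn y * (\<bar>y\<bar> powr b * exp (-y\<^sup>2))))"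
    by (intro integral_cong_AE m0 borel_measurable_has_bochner_integral[OF calculation(1)])
  ultimately have "(LINT y|lborel. hankel_kernel b 0 y) = of_real (cos (pi * b / 2) * Gamma ((b + 1) / 2))"
    by (simp only: has_bochner_integral_integral_eq of_real_0 mult_zero_right add_0_right)
  thus ?thesis using * by simp
qed

section \<open>Hankel's formula for all real exponents\<close>

text \<open>For \<open>b \<ge> 0\<close> the value on the imaginary axis agrees with the claim by
  the reflection formula, as the arguments \<open>(1 - b) / 2\<close> and \<open>(b + 1) / 2\<close>
  add up to 1. The recurrence descends to negative non-integers in steps of two, and continuity in
  \<open>b\<close> fills in the integers.\<close>

lemma hankel_formula:
  assumes a: "a > 0"
  shows "(LINT y|lborel. hankel_kernel b a y) = of_real (pi * rGamma ((1 - b) / 2))"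
proof -
  define I where "I = (\<lambda>b. LINT y|lborel. hankel_kernel b a y)"
  define P where "P = (\<lambda>b. I b = of_real (pi * rGamma ((1 - b) / 2)))"
  have base: "P b" if "b \<ge> 0" for b
  proof -
    let ?s = "(1 - b) / 2"
    have "rGamma (of_real ?s) * rGamma (1 - of_real ?s :: complex) = sin (of_real pi * of_real ?s) / of_real pi"
      by (rule rGamma_reflection_complex)
    also have "(1 - of_real ?s :: complex) = of_real (1 - ?s)" by simp
    also have "sin (of_real pi * of_real ?s :: complex) / of_real pi = of_real (sin (pi * ?s) / pi)"
      by (simp only: sin_of_real[symmetric] of_real_mult of_real_divide)
    finally have "of_real (rGamma ?s * rGamma (1 - ?s)) = (of_real (sin (pi * ?s) / pi) :: complex)"
      by (simp only: rGamma_complex_of_real of_real_mult)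
    hence "rGamma ?s * rGamma (1 - ?s) = sin (pi * ?s) / pi" by (simp only: of_real_eq_iff)
    moreover have "1 - ?s = (b + 1) / 2" by (simp add: field_simps)
    moreover have "sin (pi * ?s) = cos (pi * b / 2)"
      using cos_sin_eq[of "pi * b / 2"] by (simp add: field_simps)
    moreover have "rGamma ((b + 1) / 2) = inverse (Gamma ((b + 1) / 2))" "Gamma ((b + 1) / 2) > 0"
      using that by (auto simp: rGamma_inverse_Gamma intro!: Gamma_real_pos)
    ultimately have "pi * rGamma ?s = cos (pi * b / 2) * Gamma ((b + 1) / 2)"
      by (simp add: field_simps)
    thus ?thesis using integral_hankel_kernel_nonneg[OF a that] by (simp only: P_def I_def)
  qed
  have step: "P c" if "P (c + 2)" "c \<noteq> -1" for c
  proof -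
    let ?s = "(1 - c) / 2"
    have "2 * I (c + 2) = - of_real (c + 1) * I c"
      using integral_hankel_kernel_rec[OF a, of "c + 1"] by (simp add: I_def add_ac)
    moreover have "(?s - 1) * rGamma ?s = rGamma (?s - 1)" using rGamma_plus1[of "?s - 1"] by simp
    moreover have "I (c + 2) = of_real (pi * rGamma (?s - 1))"
      using that(1) unfolding P_def by (simp add: diff_divide_distrib add_divide_distrib)
    ultimately have "- of_real (c + 1) * I c = of_real (2 * (?s - 1) * (pi * rGamma ?s))"
      by (simp only: of_real_mult of_real_numeral mult_ac)
    also have "2 * (?s - 1) = - (c + 1)" by (simp add: field_simps)
    finally have "of_real (c + 1) * I c = of_real (c + 1) * of_real (pi * rGamma ?s)"
      by (simp only: of_real_mult of_real_minus mult_minus_left neg_equal_iff_equal)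
    moreover have "of_real (c + 1) \<noteq> (0 :: complex)"
      unfolding of_real_eq_0_iff using that(2) by linarith
    ultimately show ?thesis unfolding P_def by (metis mult_left_cancel)
  qed
  \<comment> \<open>The recurrence is void at \<open>b = - 1\<close>, where both sides vanish, so it cannot reach the negative
    odd integers; integers are instead treated as limits of non-integers.\<close>
  have noninteger: "P b" if "b > - 2 * real n" "b \<notin> \<int>" for n b
    using that
  proof (induction n arbitrary: b)
    case (Suc n)
    have "b + 2 \<notin> \<int>" using Suc.prems(2) by (metis Ints_diff Ints_numeral add_diff_cancel_right')
    moreover have "b \<noteq> -1" using Suc.prems(2) by force
    moreover have "b + 2 > - 2 * real n" using Suc.prems(1) by simp
    ultimately show ?case using Suc.IH step by blast
  qed (auto intro: base)
  have "P b"
  proof (cases "b \<in> \<int>")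
    case False
    obtain n where "real n > - b / 2" using reals_Archimedean2 by blast
    with noninteger[of n b] False show ?thesis by simp
  next
    case True
    \<comment> \<open>The summand 2 keeps every \<open>e n\<close> strictly below 1, so that
      \<open>b + e n\<close> is never an integer when \<open>b\<close> is one.\<close>
    define e where "e = (\<lambda>n. 1 / (real n + 2))"
    have e: "0 < e n" "e n < 1" "e \<longlonglongrightarrow> 0" for n
    proof -
      show "e \<longlonglongrightarrow> 0" unfolding e_def by real_asymp
    qed (auto simp: e_def)
    have nonint: "b + e n \<notin> \<int>" for n
    proof
      assume "b + e n \<in> \<int>"
      hence "e n \<in> \<int>" using True by (metis Ints_diff add_diff_cancel_left')
      thus False using e(1,2)[of n] by (auto elim!: Ints_cases)
    qed
    have "P (b + e n)" for n
    proof -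
      obtain m where "real m > - (b + e n) / 2" using reals_Archimedean2 by blast
      with noninteger[of m "b + e n"] nonint show ?thesis by simp
    qed
    hence eq: "I (b + e n) = of_real (pi * rGamma ((1 - (b + e n)) / 2))" for n by (simp add: P_def)
    have "(\<lambda>n. I (b + e n)) \<longlonglongrightarrow> I b" unfolding I_def
    proof (rule integral_dominated_convergence)
      \<comment> \<open>Since the exponent \<open>b + e n\<close> lies between \<open>b\<close> and
        \<open>b + 1\<close>, the power is dominated by the larger of the two end powers, hence by
        their sum.\<close>
      show "integrable lborel (\<lambda>y. norm (hankel_kernel b a y) + norm (hankel_kernel (b + 1) a y))"
        using integrable_hankel_kernel[OF a] by auto
      show "AE y in lborel. norm (hankel_kernel (b + e n) a y)
              \<le> norm (hankel_kernel b a y) + norm (hankel_kernel (b + 1) a y)" for n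
      proof (rule AE_I2)
        fix y
        let ?w = "Complex a y"
        have w: "norm ?w > 0" using a by (auto simp: complex_eq_iff)
        have "norm ?w powr (b + e n) \<le> norm ?w powr b + norm ?w powr (b + 1)"
        proof (cases "norm ?w \<ge> 1")
          case True
          hence "norm ?w powr (b + e n) \<le> norm ?w powr (b + 1)"
            using e(1,2)[of n] by (intro powr_mono) auto
          thus ?thesis by (simp add: add_increasing)
        next
          case False
          hence "norm ?w powr (b + e n) \<le> norm ?w powr b"
            using e(1,2)[of n] w by (intro powr_mono') auto
          thus ?thesis by (simp add: add_increasing2)
        qed
        hence "exp (a\<^sup>2 - y\<^sup>2) * norm ?w powr (b + e n) \<le> exp (a\<^sup>2 - y\<^sup>2) * (norm ?w powr b + norm ?w powr (b + 1))"
          by (intro mult_left_mono) auto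
        thus "norm (hankel_kernel (b + e n) a y) \<le> norm (hankel_kernel b a y) + norm (hankel_kernel (b + 1) a y)"
          unfolding hankel_kernel_def norm_mult norm_exp_Complex_square
          by (simp add: norm_powr_real_powr' distrib_left del: of_real_add)
      qed
      have "hankel_kernel c a y = exp ((Complex a y)\<^sup>2) * exp (of_real c * Ln (Complex a y))" for c y
        using a by (auto simp: hankel_kernel_def powr_def complex_eq_iff)
      hence "(\<lambda>n. hankel_kernel (b + e n) a y) \<longlonglongrightarrow> hankel_kernel (b + 0) a y" for y
        by (simp only:) (intro tendsto_intros e)
      thus "AE y in lborel. (\<lambda>n. hankel_kernel (b + e n) a y) \<longlonglongrightarrow> hankel_kernel b a y" by simp
    qed (rule borel_measurable_integrable, rule integrable_hankel_kernel[OF a])+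
    moreover have "(\<lambda>n. of_real (pi * rGamma ((1 - (b + e n)) / 2)) :: complex) \<longlonglongrightarrow> of_real (pi * rGamma ((1 - (b + 0)) / 2))"
    proof (intro tendsto_of_real tendsto_mult tendsto_const)
      have "isCont (rGamma :: real \<Rightarrow> real) ((1 - (b + 0)) / 2)" by (intro continuous_intros)
      moreover have "(\<lambda>n. (1 - (b + e n)) / 2) \<longlonglongrightarrow> (1 - (b + 0)) / 2" by (intro tendsto_intros e) auto
      ultimately show "(\<lambda>n. rGamma ((1 - (b + e n)) / 2)) \<longlonglongrightarrow> rGamma ((1 - (b + 0)) / 2)"
        by (rule isCont_tendsto_compose)
    qed
    ultimately show ?thesis unfolding eq P_def using LIMSEQ_unique[of _ "I b"] by (simp only: add_0_right)
  qed
  thus ?thesis by (simp add: P_def I_def)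
qed

section \<open>The Fourier transform of the M-function\<close>

definition mittag_leffler :: "real \<Rightarrow> real \<Rightarrow> real" where
  "mittag_leffler \<nu> y = (\<Sum>n. rGamma (1 + \<nu> * real n) * y ^ n)"

text \<open>Hankel's formula with absolute values inside the integral. The line \<open>a\<close>
  stays free: a large \<open>a\<close> makes \<open>a powr b\<close> decay faster than any
  prescribed geometric rate as \<open>b\<close> tends to minus infinity.\<close>

lemma abs_rGamma_le:
  assumes a: "a > 0" and b: "b \<le> 0"
  shows "\<bar>rGamma ((1 - b) / 2)\<bar> \<le> exp (a\<^sup>2) * (LINT y|lborel. exp (- y\<^sup>2)) / pi * a powr b"
proof -
  have I: "integrable lborel (\<lambda>y::real. exp (- y\<^sup>2))"
    using integrable_exp_abs_minus_square[of 0] by simp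
  have "pi * \<bar>rGamma ((1 - b) / 2)\<bar> = norm (LINT y|lborel. hankel_kernel b a y)"
    unfolding hankel_formula[OF a] norm_of_real by (simp add: abs_mult)
  also have "\<dots> \<le> (LINT y|lborel. norm (hankel_kernel b a y))" by (rule integral_norm_bound)
  also have "\<dots> \<le> (LINT y|lborel. (exp (a\<^sup>2) * a powr b) * exp (- y\<^sup>2))"
  proof (rule integral_mono)
    show "norm (hankel_kernel b a y) \<le> (exp (a\<^sup>2) * a powr b) * exp (- y\<^sup>2)" for y
    proof -
      have "norm (hankel_kernel b a y) \<le> exp (a\<^sup>2 - y\<^sup>2) * a powr b"
        unfolding hankel_kernel_def norm_mult norm_exp_Complex_square
        by (intro mult_left_mono norm_Complex_powr_le' a b) auto
      thus ?thesis by (simp add: exp_diff exp_minus field_simps)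
    qed
  qed (use I integrable_hankel_kernel[OF a] in auto)
  also have "\<dots> = exp (a\<^sup>2) * a powr b * (LINT y|lborel. exp (- y\<^sup>2))" by simp
  finally show ?thesis by (simp add: field_simps)
qed

lemma summable_mittag_leffler:
  assumes "\<nu> > 0"
  shows "summable (\<lambda>n. norm (rGamma (1 + \<nu> * real n) * y ^ n))"
proof -
  \<comment> \<open>Chosen so that \<open>a powr (2 * \<nu>)\<close> is twice
    \<open>\<bar>y\<bar> + 1\<close>: with \<open>b = - 1 - 2 * \<nu> * real n\<close> the terms are
    then at most a constant times \<open>(1 / 2) ^ n\<close>. The summand 1 keeps \<open>a\<close>
    positive at \<open>y = 0\<close>.\<close>
  define a where "a = (2 * (\<bar>y\<bar> + 1)) powr (1 / (2 * \<nu>))"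
  have a: "a > 0" by (simp add: a_def)
  have a2: "a powr (2 * \<nu>) = 2 * (\<bar>y\<bar> + 1)" using assms by (simp add: a_def powr_powr)
  define C where "C = exp (a\<^sup>2) * (LINT y|lborel. exp (- y\<^sup>2)) / pi * a powr (-1)"
  show ?thesis
  proof (rule summable_comparison_test')
    show "summable (\<lambda>n. C * (1 / 2) ^ n)" by (intro summable_mult summable_geometric) auto
    fix n :: nat
    have cancel: "C * inverse ((2 * z) ^ n) * z ^ n = C * (1 / 2) ^ n" if "z > 0" for z :: real
      using that by (simp add: power_mult_distrib power_divide divide_simps)
    have C: "C \<ge> 0" by (auto simp: C_def intro!: integral_nonneg)
    have "(1 - (- 1 - 2 * \<nu> * real n)) / 2 = 1 + \<nu> * real n" by (simp add: field_simps)
    moreover have "- 1 - 2 * \<nu> * real n \<le> 0"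
      using assms mult_nonneg_nonneg[of \<nu> "real n"] by linarith
    ultimately have "\<bar>rGamma (1 + \<nu> * real n)\<bar> \<le> exp (a\<^sup>2) * (LINT y|lborel. exp (- y\<^sup>2)) / pi * a powr (- 1 - 2 * \<nu> * real n)"
      using abs_rGamma_le[OF a, of "- 1 - 2 * \<nu> * real n"] by (simp only:)
    also have "a powr (- 1 - 2 * \<nu> * real n) = a powr (-1) * inverse ((a powr (2 * \<nu>)) ^ n)"
      using a by (simp add: powr_diff powr_powr powr_realpow[symmetric] field_simps powr_minus)
    finally have "\<bar>rGamma (1 + \<nu> * real n)\<bar> \<le> C * inverse ((a powr (2 * \<nu>)) ^ n)"
      by (simp add: C_def mult_ac)
    note this[unfolded a2]
    hence "\<bar>rGamma (1 + \<nu> * real n)\<bar> * \<bar>y\<bar> ^ n \<le> C * inverse ((2 * (\<bar>y\<bar> + 1)) ^ n) * (\<bar>y\<bar> + 1) ^ n"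
      using C by (intro mult_mono power_mono) auto
    also have "C * inverse ((2 * (\<bar>y\<bar> + 1)) ^ n) * (\<bar>y\<bar> + 1) ^ n = C * (1 / 2) ^ n"
      by (rule cancel) simp
    finally show "norm (norm (rGamma (1 + \<nu> * real n) * y ^ n)) \<le> C * (1 / 2) ^ n"
      by (simp add: abs_mult power_abs)
  qed
qed

section \<open>Integral representation of the M-function\<close>

lemma sum_exp_series_le:
  fixes z :: real
  assumes "z \<ge> 0"
  shows "(\<Sum>n<N. z ^ n /\<^sub>R fact n) \<le> exp z"
  using sum_le_suminf[OF sums_summable[OF exp_converges[of z]], of "{..<N}"] exp_converges[of z] assms
  by (auto simp: sums_iff)

text \<open>Hankel's formula with exponent \<open>\<nu> * (real n + 1) - 1\<close> produces the n-th
  coefficient of the series, and under the integral the powers sum to an exponential. Summation and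
  integration may be exchanged because \<open>\<nu> < 1\<close> lets the exponent grow at most
  linearly in \<open>\<bar>y\<bar>\<close>, which the Gaussian factor beats.\<close>

lemma wright_M_hankel:
  assumes nu: "0 < \<nu>" "\<nu> < 1" and a: "a > 0"
  shows "of_real (wright_M (\<nu> / 2) x) =
    (1 / of_real pi) * (LINT y|lborel. hankel_kernel (\<nu> - 1) a y * exp (- (of_real x * Complex a y powr of_real \<nu>)))"
proof -
  let ?w = "\<lambda>y. Complex a y"
  define c where "c = (\<lambda>n. (rGamma (- (\<nu> / 2) * real n + 1 - \<nu> / 2) / fact n) *\<^sub>R (- x) ^ n)"
  define T where "T = (\<lambda>n y. hankel_kernel (\<nu> - 1) a y * ((- (of_real x * ?w y powr of_real \<nu>)) ^ n /\<^sub>R fact n))"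
  have T_eq: "T n y = (of_real ((- x) ^ n / fact n)) * hankel_kernel (\<nu> * (real n + 1) - 1) a y" for n y
  proof -
    have nz: "?w y \<noteq> 0" using a by (auto simp: complex_eq_iff)
    have "(?w y powr of_real \<nu>) ^ n = ?w y powr (of_real \<nu> * of_nat n)"
      by (simp add: powr_def nz exp_of_nat_mult[symmetric] mult_ac)
    moreover have "?w y powr of_real (\<nu> * (real n + 1) - 1) = ?w y powr of_real (\<nu> - 1) * ?w y powr (of_real \<nu> * of_nat n)"
      by (simp add: powr_add[symmetric] algebra_simps)
    moreover have "(- (of_real x * ?w y powr of_real \<nu>)) ^ n = of_real ((- x) ^ n) * (?w y powr of_real \<nu>) ^ n"
      by (simp add: power_mult_distrib[symmetric])
    ultimately show ?thesis
      by (simp add: T_def hankel_kernel_def scaleR_conv_of_real field_simps)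
  qed
  have T_int: "(LINT y|lborel. T n y) = of_real (pi * c n)" for n
  proof -
    have "(1 - (\<nu> * (real n + 1) - 1)) / 2 = - (\<nu> / 2) * real n + 1 - \<nu> / 2" by (simp add: field_simps)
    thus ?thesis unfolding T_eq integral_mult_right_zero hankel_formula[OF a]
      by (simp only: c_def) (simp add: field_simps)
  qed
  have T_integrable: "integrable lborel (T n)" for n
    unfolding T_eq using integrable_hankel_kernel[OF a] by simp
  have "(\<lambda>N. LINT y|lborel. (\<Sum>n<N. T n y)) \<longlonglongrightarrow>
     (LINT y|lborel. hankel_kernel (\<nu> - 1) a y * exp (- (of_real x * ?w y powr of_real \<nu>)))"
  proof (rule integral_dominated_convergence)
    show "AE y in lborel. (\<lambda>N. \<Sum>n<N. T n y) \<longlonglongrightarrow> hankel_kernel (\<nu> - 1) a y * exp (- (of_real x * ?w y powr of_real \<nu>))"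
      unfolding T_def sum_distrib_left[symmetric]
      by (intro AE_I2 tendsto_mult tendsto_const exp_converges[unfolded sums_def])
    show "AE y in lborel. norm (\<Sum>n<N. T n y) \<le> (exp (a\<^sup>2) * a powr (\<nu> - 1) * exp (\<bar>x\<bar> * (1 + a))) * exp (\<bar>x\<bar> * \<bar>y\<bar> - y\<^sup>2)" for N
    proof (rule AE_I2)
      fix y
      have w: "norm (?w y powr of_real \<nu>) \<le> 1 + a + \<bar>y\<bar>"
      proof -
        \<comment> \<open>Adding 1 makes the base at least 1, so that raising the exponent from
          \<open>\<nu>\<close> to 1 increases the power.\<close>
        have "norm (?w y) powr \<nu> \<le> (1 + norm (?w y)) powr \<nu>" using nu by (intro powr_mono2) auto
        also have "\<dots> \<le> (1 + norm (?w y)) powr 1" using nu by (intro powr_mono) auto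
        finally have "norm (?w y) powr \<nu> \<le> 1 + norm (?w y)" by simp
        thus ?thesis using norm_Complex_bounds(2)[of a y] a by (simp add: norm_powr_real_powr')
      qed
      have "norm (\<Sum>n<N. T n y) \<le> (\<Sum>n<N. norm (T n y))" by (rule norm_sum)
      also have "\<dots> = norm (hankel_kernel (\<nu> - 1) a y) * (\<Sum>n<N. (\<bar>x\<bar> * norm (?w y powr of_real \<nu>)) ^ n /\<^sub>R fact n)"
        by (simp add: T_def sum_distrib_left norm_mult norm_power power_mult_distrib field_simps)
      also have "\<dots> \<le> norm (hankel_kernel (\<nu> - 1) a y) * exp (\<bar>x\<bar> * norm (?w y powr of_real \<nu>))"
        by (intro mult_left_mono sum_exp_series_le) auto
      also have "\<dots> \<le> (exp (a\<^sup>2 - y\<^sup>2) * a powr (\<nu> - 1)) * exp (\<bar>x\<bar> * (1 + a + \<bar>y\<bar>))"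
        unfolding hankel_kernel_def norm_mult norm_exp_Complex_square
        using nu a w by (intro mult_mono norm_Complex_powr_le') (auto intro!: mult_left_mono)
      also have "\<dots> = (exp (a\<^sup>2) * a powr (\<nu> - 1) * exp (\<bar>x\<bar> * (1 + a))) * exp (\<bar>x\<bar> * \<bar>y\<bar> - y\<^sup>2)"
        by (simp add: exp_diff exp_add distrib_left field_simps)
      finally show "norm (\<Sum>n<N. T n y) \<le> (exp (a\<^sup>2) * a powr (\<nu> - 1) * exp (\<bar>x\<bar> * (1 + a))) * exp (\<bar>x\<bar> * \<bar>y\<bar> - y\<^sup>2)" .
    qed
    show "integrable lborel (\<lambda>y. (exp (a\<^sup>2) * a powr (\<nu> - 1) * exp (\<bar>x\<bar> * (1 + a))) * exp (\<bar>x\<bar> * \<bar>y\<bar> - y\<^sup>2))"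
      by (intro integrable_mult_right integrable_exp_abs_minus_square)
    show "(\<lambda>y. hankel_kernel (\<nu> - 1) a y * exp (- (of_real x * ?w y powr of_real \<nu>))) \<in> borel_measurable lborel"
    proof -
      have "continuous_on UNIV (\<lambda>y. hankel_kernel (\<nu> - 1) a y * exp (- (of_real x * ?w y powr of_real \<nu>)))"
        unfolding Complex_conv
        by (intro continuous_intros continuous_on_hankel_kernel) (use a in \<open>auto simp: complex_eq_iff\<close>)
      thus ?thesis by (auto intro: borel_measurable_continuous_onI)
    qed
    show "(\<lambda>y. \<Sum>n<N. T n y) \<in> borel_measurable lborel" for N
      using T_integrable by (intro borel_measurable_sum) (auto intro: borel_measurable_integrable)
  qed
  hence lim: "(\<lambda>N. of_real (\<Sum>n<N. pi * c n)) \<longlonglongrightarrow>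
     (LINT y|lborel. hankel_kernel (\<nu> - 1) a y * exp (- (of_real x * ?w y powr of_real \<nu>)))" (is "_ \<longlonglongrightarrow> ?L")
    using T_integrable by (simp add: Bochner_Integration.integral_sum T_int)
  \<comment> \<open>The real parts give convergence of the series of M together with its value; the
    imaginary parts are constantly 0 and show that the integral is real.\<close>
  have "(\<lambda>N. Re (of_real (\<Sum>n<N. pi * c n))) \<longlonglongrightarrow> Re ?L" by (intro tendsto_Re lim)
  hence "(\<lambda>n. pi * c n) sums Re ?L" by (simp add: sums_def)
  hence "c sums (Re ?L / pi)" using sums_divide[of "\<lambda>n. pi * c n" "Re ?L" pi] by simp
  hence M: "wright_M (\<nu> / 2) x = Re ?L / pi" by (simp add: wright_M_def c_def sums_iff)
  have "(\<lambda>N. Im (of_real (\<Sum>n<N. pi * c n))) \<longlonglongrightarrow> Im ?L" by (intro tendsto_Im lim)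
  hence "Im ?L = 0" by (simp add: LIMSEQ_const_iff)
  hence "?L = of_real (pi * (Re ?L / pi))" by (simp add: complex_eq_iff)
  thus ?thesis unfolding M[symmetric] by (simp only: of_real_mult) simp
qed

section \<open>Fourier transform of a two-sided exponential\<close>

text \<open>Integrability comes from the modulus \<open>exp (- Re p * x)\<close>, the value from the
  primitive -exp(-px)/p.\<close>

lemma has_bochner_integral_exp_halfline:
  fixes p :: complex
  assumes "Re p > 0"
  shows "has_bochner_integral lborel (\<lambda>x. indicator {0..} x *\<^sub>R exp (- (p * of_real x))) (1 / p)"
proof -
  have "(\<lambda>x. exp (- Re p * x)) absolutely_integrable_on {0..}"
    using has_integral_exp_minus_to_infinity[OF assms, of 0]
    by (intro nonnegative_absolutely_integrable_1) (auto simp: has_integral_integrable)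
  hence "set_integrable lborel {0..} (\<lambda>x. exp (- Re p * x))"
    unfolding set_integrable_def by (subst (asm) integrable_completion) auto
  hence int: "set_integrable lborel {0..} (\<lambda>x. exp (- (p * of_real x)))"
    unfolding set_integrable_def
    by (rule Bochner_Integration.integrable_bound) (auto simp: indicator_def)
  have "(LBINT x=ereal 0..\<infinity>. exp (- (p * of_real x))) = 0 - (- 1 / p)"
  proof (rule interval_integral_FTC_integrable)
    show "((\<lambda>x. - exp (- (p * of_real x)) / p) has_vector_derivative exp (- (p * of_real x))) (at x)" for x :: real
    proof -
      have "((\<lambda>z. - exp (- (p * z)) / p) has_field_derivative exp (- (p * of_real x))) (at (of_real x))"
        using assms by (auto intro!: derivative_eq_intros)
      from has_vector_derivative_real_field[OF this] show ?thesis .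
    qed
    show "isCont (\<lambda>x. exp (- (p * of_real x))) x" for x :: real by (intro continuous_intros)
    show "set_integrable lborel (einterval (ereal 0) \<infinity>) (\<lambda>x. exp (- (p * of_real x)))"
      by (rule set_integrable_subset[OF int]) (auto simp: einterval_def)
    have "((\<lambda>x. - exp (- (p * of_real x)) / p) \<longlongrightarrow> - exp (- (p * of_real 0)) / p) (at_right 0)"
      using assms by (intro tendsto_intros) auto
    thus "(((\<lambda>x. - exp (- (p * of_real x)) / p) \<circ> real_of_ereal) \<longlongrightarrow> - 1 / p) (at_right (ereal 0))"
      by (simp add: ereal_tendsto_simps)
    have "((\<lambda>x. - exp (- (p * of_real x)) / p) \<longlongrightarrow> 0) at_top"
    proof (rule Lim_null_comparison)
      show "\<forall>\<^sub>F x in at_top. norm (- exp (- (p * of_real x)) / p) \<le> exp (- Re p * x) / norm p"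
        by (simp add: norm_divide)
      have "((\<lambda>x. exp (- c * x)) \<longlongrightarrow> 0) at_top" if "c > 0" for c :: real using that by real_asymp
      from tendsto_divide_zero[OF this[OF assms]]
      show "((\<lambda>x. exp (- Re p * x) / norm p) \<longlongrightarrow> 0) at_top" .
    qed
    thus "(((\<lambda>x. - exp (- (p * of_real x)) / p) \<circ> real_of_ereal) \<longlongrightarrow> 0) (at_left \<infinity>)"
      by (simp add: ereal_tendsto_simps)
  qed auto
  hence "(LINT x:{0<..}|lborel. exp (- (p * of_real x))) = 1 / p"
    by (simp add: interval_integral_to_infinity_eq)
  moreover have "(LINT x:{0<..}|lborel. exp (- (p * of_real x))) = (LINT x:{0..}|lborel. exp (- (p * of_real x)))"
    unfolding set_lebesgue_integral_def
  proof (rule integral_cong_AE)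
    show "AE x in lborel. indicat_real {0<..} x *\<^sub>R exp (- (p * of_real x)) = indicat_real {0..} x *\<^sub>R exp (- (p * of_real x))"
      using AE_lborel_singleton[of "0::real"] by eventually_elim (auto simp: indicator_def)
  qed auto
  ultimately show ?thesis using int
    by (simp add: has_bochner_integral_iff set_integrable_def set_lebesgue_integral_def)
qed

text \<open>The positive half-line contributes 1/(A - ik), the reflected negative one 1/(A +
  ik).\<close>

lemma has_bochner_integral_exp_abs_fourier:
  fixes A :: complex
  assumes "Re A > 0"
  shows "has_bochner_integral lborel (\<lambda>x. exp (\<i> * of_real k * of_real x) * exp (- (of_real \<bar>x\<bar> * A)))
    (2 * A / (A\<^sup>2 + of_real k ^ 2))"
proof -
  have "has_bochner_integral lborel (\<lambda>x. indicator {0..} x *\<^sub>R exp (- ((A - \<i> * of_real k) * of_real x))) (1 / (A - \<i> * of_real k))"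
    using assms by (intro has_bochner_integral_exp_halfline) auto
  moreover have "has_bochner_integral lborel (\<lambda>x. indicator {0..} (-x) *\<^sub>R exp (- ((A + \<i> * of_real k) * of_real (-x)))) (1 / (A + \<i> * of_real k))"
  proof -
    have "has_bochner_integral lborel (\<lambda>x. indicator {0..} x *\<^sub>R exp (- ((A + \<i> * of_real k) * of_real x))) (1 / (A + \<i> * of_real k))"
      using assms by (intro has_bochner_integral_exp_halfline) auto
    from lborel_has_bochner_integral_real_affine_iff[THEN iffD1, OF _ this, of "-1" 0]
    show ?thesis by simp
  qed
  ultimately have "has_bochner_integral lborel (\<lambda>x. indicator {0..} x *\<^sub>R exp (- ((A - \<i> * of_real k) * of_real x)) +
     indicator {0..} (-x) *\<^sub>R exp (- ((A + \<i> * of_real k) * of_real (-x)))) (1 / (A - \<i> * of_real k) + 1 / (A + \<i> * of_real k))"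
    by (rule has_bochner_integral_add)
  also have "1 / (A - \<i> * of_real k) + 1 / (A + \<i> * of_real k) = 2 * A / (A\<^sup>2 + of_real k ^ 2)"
  proof -
    have "A - \<i> * of_real k \<noteq> 0" "A + \<i> * of_real k \<noteq> 0" using assms by (auto simp: complex_eq_iff)
    moreover have "A\<^sup>2 + of_real k ^ 2 = (A - \<i> * of_real k) * (A + \<i> * of_real k)"
      by (simp add: algebra_simps power2_eq_square)
    ultimately show ?thesis by (simp add: add_frac_eq)
  qed
  finally show ?thesis
  proof (rule has_bochner_integral_cong_AE[THEN iffD1, rotated -1])
    show "AE x in lborel. indicator {0..} x *\<^sub>R exp (- ((A - \<i> * of_real k) * of_real x)) +
     indicator {0..} (-x) *\<^sub>R exp (- ((A + \<i> * of_real k) * of_real (-x))) = exp (\<i> * of_real k * of_real x) * exp (- (of_real \<bar>x\<bar> * A))"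
      \<comment> \<open>At 0 both indicators equal 1, so the point is counted twice and has to be
        excluded.\<close>
      using AE_lborel_singleton[of "0::real"]
      by eventually_elim (auto simp: indicator_def exp_add[symmetric] algebra_simps abs_real_def)
  qed auto
qed

section \<open>Fourier transform of the proposed solution\<close>

lemma cos_half_pi_mult_pos:
  assumes "0 < \<nu>" "\<nu> < 1"
  shows "cos (\<nu> * pi / 2) > 0"
proof (rule cos_gt_zero_pi)
  have "0 < \<nu> * pi" using assms by simp
  thus "- (pi / 2) < \<nu> * pi / 2" using pi_gt_zero by linarith
  show "\<nu> * pi / 2 < pi / 2" using assms by simp
qed

text \<open>The argument of \<open>Complex a y\<close> lies within a right angle, so that of its
  power is at most \<open>\<nu> * pi / 2\<close> in absolute value, and the modulus is at least
  \<open>a\<close>. The bound is uniform in \<open>y\<close> and gives exponential decay in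
  \<open>\<bar>x\<bar>\<close>.\<close>

lemma Re_Complex_powr_ge:
  assumes nu: "0 < \<nu>" "\<nu> < 1" and a: "a > 0"
  shows "a powr \<nu> * cos (\<nu> * pi / 2) \<le> Re (Complex a y powr of_real \<nu>)"
proof -
  let ?w = "Complex a y"
  have nz: "?w \<noteq> 0" using a by (auto simp: complex_eq_iff)
  have Im: "\<bar>Im (Ln ?w)\<bar> < pi / 2" using a by (intro Re_Ln_pos_lt_imp) simp
  have "\<nu> * \<bar>Im (Ln ?w)\<bar> \<le> \<nu> * (pi / 2)" using Im nu by (intro mult_left_mono) auto
  moreover have "\<nu> * (pi / 2) \<le> 1 * (pi / 2)" using nu by (intro mult_right_mono) auto
  ultimately have "cos (\<nu> * (pi / 2)) \<le> cos (\<nu> * \<bar>Im (Ln ?w)\<bar>)"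
    using nu by (intro cos_monotone_0_pi_le) auto
  also have "cos (\<nu> * \<bar>Im (Ln ?w)\<bar>) = cos (\<nu> * Im (Ln ?w))" by (cases "Im (Ln ?w) \<ge> 0") auto
  finally have c: "cos (\<nu> * pi / 2) \<le> cos (\<nu> * Im (Ln ?w))" by simp
  have "0 \<le> cos (\<nu> * pi / 2)"
    using cos_half_pi_mult_pos[OF nu] by simp
  moreover have "a powr \<nu> \<le> norm ?w powr \<nu>"
    using nu a norm_Complex_bounds(1)[of a y] by (intro powr_mono2) auto
  ultimately have "a powr \<nu> * cos (\<nu> * pi / 2) \<le> norm ?w powr \<nu> * cos (\<nu> * Im (Ln ?w))"
    using c by (intro mult_mono) auto
  also have "\<dots> = Re (?w powr of_real \<nu>)"
    using nz by (simp add: powr_def Re_exp)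
  finally show ?thesis .
qed

lemma integrable_exp_minus_abs:
  assumes "d > (0::real)"
  shows "integrable lborel (\<lambda>x. exp (- (\<bar>x\<bar> * d)))"
proof -
  have "integrable lborel (\<lambda>x. norm (exp (\<i> * of_real 0 * of_real x) * exp (- (of_real \<bar>x\<bar> * complex_of_real d))))"
    using has_bochner_integral_exp_abs_fourier[of "of_real d" 0] assms
    by (intro integrable_norm) (auto intro: integrable.intros)
  thus ?thesis by simp
qed

text \<open>With the integral representation inserted, the real part of \<open>A y\<close> is at
  least some \<open>d > 0\<close>, which yields a product majorant for Fubini; the inner integral
  over \<open>x\<close> is that of a two-sided exponential. The factor 2 it brings cancels the 1/2
  in front of the solution.\<close>

lemma fourier_wright_MM_hankel:
  assumes nu: "0 < \<nu>" "\<nu> < 1" and a: "a > 0" and s: "s > 0"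
  defines "A \<equiv> \<lambda>y. Complex a y powr of_real \<nu> * of_real (s powr - (\<nu> / 2))"
  shows "integrable lborel (\<lambda>x. exp (\<i> * of_real k * of_real x) * of_real (1 / 2 * wright_MM (\<nu> / 2) \<bar>x\<bar> s))"
    and "(LINT x|lborel. exp (\<i> * of_real k * of_real x) * of_real (1 / 2 * wright_MM (\<nu> / 2) \<bar>x\<bar> s)) =
      (1 / of_real pi) * (LINT y|lborel. hankel_kernel (-1) a y * ((A y)\<^sup>2 / ((A y)\<^sup>2 + of_real k ^ 2)))"
proof -
  define S where "S = s powr - (\<nu> / 2)"
  have S: "S > 0" using s by (simp add: S_def)
  define \<Phi> where "\<Phi> = (\<lambda>x y. hankel_kernel (\<nu> - 1) a y * of_real S * (exp (\<i> * of_real k * of_real x) * exp (- (of_real \<bar>x\<bar> * A y))))"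
  define d where "d = a powr \<nu> * cos (\<nu> * pi / 2) * S"
  have d: "d > 0" using a S cos_half_pi_mult_pos[OF nu] by (simp add: d_def)
  have ReA: "Re (A y) \<ge> d" for y
    using Re_Complex_powr_ge[OF nu a, of y] S by (simp add: A_def d_def S_def[symmetric] mult_right_mono)
  have 1: "exp (\<i> * of_real k * of_real x) * of_real (1 / 2 * wright_MM (\<nu> / 2) \<bar>x\<bar> s) =
      (1 / (2 * of_real pi)) * (LINT y|lborel. \<Phi> x y)" for x
  proof -
    have "1 / s powr (\<nu> / 2) = S" using s by (simp add: S_def powr_minus_divide)
    moreover from this have "\<bar>x\<bar> / s powr (\<nu> / 2) = \<bar>x\<bar> * S" by (metis times_divide_eq_right mult_1_right)
    ultimately have "wright_MM (\<nu> / 2) \<bar>x\<bar> s = S * wright_M (\<nu> / 2) (\<bar>x\<bar> * S)"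
      by (simp only: wright_MM_def)
    moreover have "(LINT y|lborel. \<Phi> x y) = (of_real S * exp (\<i> * of_real k * of_real x)) *
       (LINT y|lborel. hankel_kernel (\<nu> - 1) a y * exp (- (of_real (\<bar>x\<bar> * S) * Complex a y powr of_real \<nu>)))"
      unfolding \<Phi>_def integral_mult_right_zero[symmetric]
      by (intro Bochner_Integration.integral_cong refl) (simp only: A_def S_def[symmetric] of_real_mult mult_ac)
    ultimately show ?thesis
      by (simp add: wright_M_hankel[OF nu a] mult_ac)
  qed
  have int: "integrable (lborel \<Otimes>\<^sub>M lborel) (case_prod \<Phi>)"
  proof (rule integrable_lborel_pair_bound)
    have "continuous_on UNIV (\<lambda>p. \<Phi> (fst p) (snd p))"
      unfolding \<Phi>_def A_def Complex_conv
      by (intro continuous_intros continuous_on_hankel_kernel) (use a in \<open>auto simp: complex_eq_iff\<close>)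
    thus "case_prod \<Phi> \<in> borel_measurable borel"
      by (auto intro: borel_measurable_continuous_onI simp: case_prod_beta')
    show "integrable lborel (\<lambda>x. exp (- (\<bar>x\<bar> * d)))" by (rule integrable_exp_minus_abs[OF d])
    show "integrable lborel (\<lambda>y. norm (hankel_kernel (\<nu> - 1) a y) * S)"
      using integrable_hankel_kernel[OF a] by simp
    fix x y
    have "norm (\<Phi> x y) = norm (hankel_kernel (\<nu> - 1) a y) * S * exp (- (\<bar>x\<bar> * Re (A y)))"
      using S by (simp add: \<Phi>_def norm_mult)
    also have "\<dots> \<le> norm (hankel_kernel (\<nu> - 1) a y) * S * exp (- (\<bar>x\<bar> * d))"
      using S ReA[of y] by (intro mult_left_mono) (auto intro!: mult_left_mono)
    finally show "norm (case (x, y) of (x, y) \<Rightarrow> \<Phi> x y) \<le> exp (- (\<bar>x\<bar> * d)) * (norm (hankel_kernel (\<nu> - 1) a y) * S)"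
      by (simp add: mult_ac)
  qed
  have inner: "(LINT x|lborel. \<Phi> x y) = 2 * (hankel_kernel (-1) a y * ((A y)\<^sup>2 / ((A y)\<^sup>2 + of_real k ^ 2)))" for y
  proof -
    have "(LINT x|lborel. exp (\<i> * of_real k * of_real x) * exp (- (of_real \<bar>x\<bar> * A y))) = 2 * A y / ((A y)\<^sup>2 + of_real k ^ 2)"
      using ReA[of y] d by (intro has_bochner_integral_integral_eq has_bochner_integral_exp_abs_fourier) auto
    hence "(LINT x|lborel. \<Phi> x y) = hankel_kernel (\<nu> - 1) a y * of_real S * (2 * A y / ((A y)\<^sup>2 + of_real k ^ 2))"
      by (simp add: \<Phi>_def)
    \<comment> \<open>The scale factor and the power \<open>\<nu>\<close> combine to
      \<open>A y\<close>, leaving the exponent -1 that starts the Mittag-Leffler series.\<close>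
    also have "hankel_kernel (\<nu> - 1) a y * of_real S = hankel_kernel (-1) a y * A y"
      using powr_add[of "Complex a y" "-1" "of_real \<nu>"]
      by (simp add: hankel_kernel_def A_def S_def[symmetric] mult_ac)
    finally show ?thesis by (simp add: power2_eq_square mult_ac)
  qed
  have "integrable lborel (\<lambda>x. LINT y|lborel. \<Phi> x y)"
    using lborel_pair.integrable_fst'[OF int] by simp
  thus "integrable lborel (\<lambda>x. exp (\<i> * of_real k * of_real x) * of_real (1 / 2 * wright_MM (\<nu> / 2) \<bar>x\<bar> s))"
    unfolding 1 by simp
  have "(LINT x|lborel. LINT y|lborel. \<Phi> x y) = (LINT y|lborel. LINT x|lborel. \<Phi> x y)"
    using lborel_pair.Fubini_integral[OF int] by simp
  also have "\<dots> = 2 * (LINT y|lborel. hankel_kernel (-1) a y * ((A y)\<^sup>2 / ((A y)\<^sup>2 + of_real k ^ 2)))"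
    unfolding inner by (rule integral_mult_right_zero)
  finally show "(LINT x|lborel. exp (\<i> * of_real k * of_real x) * of_real (1 / 2 * wright_MM (\<nu> / 2) \<bar>x\<bar> s)) =
      (1 / of_real pi) * (LINT y|lborel. hankel_kernel (-1) a y * ((A y)\<^sup>2 / ((A y)\<^sup>2 + of_real k ^ 2)))"
    unfolding 1 integral_mult_right_zero by simp
qed

text \<open>On a line far enough to the right the quotient expands into a geometric series in
  \<open>Q\<close>, and Hankel's formula with exponent \<open>- 1 - 2 * \<nu> * real n\<close> turns
  the n-th term into \<open>rGamma (1 + \<nu> * real n)\<close>.\<close>

lemma fourier_wright_MM:
  assumes nu: "0 < \<nu>" "\<nu> < 1" and s: "s > 0"
  shows "(LINT x|lborel. exp (\<i> * of_real k * of_real x) * of_real (1 / 2 * wright_MM (\<nu> / 2) \<bar>x\<bar> s)) =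
    of_real (mittag_leffler \<nu> (- (k\<^sup>2 * s powr \<nu>)))"
proof -
  \<comment> \<open>This makes \<open>a powr (2 * \<nu>)\<close> exceed twice
    \<open>k\<^sup>2 * s powr \<nu>\<close>, whence \<open>Q\<close> has norm at most 1/2. The
    summand 1 keeps \<open>a\<close> positive at \<open>k = 0\<close>.\<close>
  define a where "a = (2 * k\<^sup>2 * s powr \<nu> + 1) powr (1 / (2 * \<nu>))"
  have p: "2 * k\<^sup>2 * s powr \<nu> + 1 > 0" using s by (intro add_nonneg_pos) auto
  hence a: "a > 0" by (simp add: a_def)
  have a2: "a powr (2 * \<nu>) = 2 * k\<^sup>2 * s powr \<nu> + 1" using nu p by (simp add: a_def powr_powr)
  define A where "A = (\<lambda>y. Complex a y powr of_real \<nu> * of_real (s powr - (\<nu> / 2)))"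
  define Q where "Q = (\<lambda>y. - (of_real (k\<^sup>2) / (A y)\<^sup>2))"
  have nz: "Complex a y \<noteq> 0" for y using a by (auto simp: complex_eq_iff)
  have Anz: "A y \<noteq> 0" for y using nz s by (simp add: A_def)
  have A2: "(A y)\<^sup>2 = Complex a y powr of_real (2 * \<nu>) / of_real (s powr \<nu>)" for y
  proof -
    have "(Complex a y powr of_real \<nu>)\<^sup>2 = Complex a y powr of_real (2 * \<nu>)"
      using nz by (simp add: powr_def exp_of_nat_mult[symmetric, of 2] mult_ac flip: exp_double)
    moreover have "(s powr - (\<nu> / 2))\<^sup>2 = 1 / s powr \<nu>"
      using s by (simp add: power2_eq_square powr_add[symmetric] powr_minus_divide)
    ultimately show ?thesis unfolding A_def power_mult_distrib of_real_power[symmetric] by simp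
  qed
  have normQ: "norm (Q y) \<le> 1 / 2" for y
  proof -
    have "a powr (2 * \<nu>) \<le> norm (Complex a y) powr (2 * \<nu>)"
      using nu a norm_Complex_bounds(1)[of a y] by (intro powr_mono2) auto
    hence "2 * (k\<^sup>2 * s powr \<nu>) \<le> norm (Complex a y) powr (2 * \<nu>)" unfolding a2 by simp
    moreover have "norm (Q y) = k\<^sup>2 * s powr \<nu> / norm (Complex a y) powr (2 * \<nu>)"
      unfolding Q_def A2 by (simp add: norm_mult norm_divide norm_power norm_powr_real_powr' del: of_real_mult)
    moreover have "norm (Complex a y) powr (2 * \<nu>) > 0" using nz[of y] by simp
    ultimately show ?thesis by (simp only: pos_divide_le_eq)
  qed
  define T where "T = (\<lambda>n y. hankel_kernel (-1) a y * Q y ^ n)"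
  have T_eq: "T n y = of_real ((- (k\<^sup>2 * s powr \<nu>)) ^ n) * hankel_kernel (- 1 - 2 * \<nu> * real n) a y" for n y
  proof -
    have "Q y = of_real (- (k\<^sup>2 * s powr \<nu>)) * Complex a y powr of_real (- 2 * \<nu>)"
      unfolding Q_def A2 using nz[of y] by (simp add: powr_minus field_simps)
    hence "Q y ^ n = of_real ((- (k\<^sup>2 * s powr \<nu>)) ^ n) * (Complex a y powr of_real (- 2 * \<nu>)) ^ n"
      by (simp only: power_mult_distrib of_real_power)
    also have "(Complex a y powr of_real (- 2 * \<nu>)) ^ n = Complex a y powr of_real (- 2 * \<nu> * real n)"
      using nz by (simp add: powr_def exp_of_nat_mult[symmetric] mult_ac)
    finally show ?thesis
      using powr_add[of "Complex a y" "of_real (-1)" "of_real (- 2 * \<nu> * real n)"]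
      by (simp add: T_def hankel_kernel_def)
  qed
  have T_int: "(LINT y|lborel. T n y) = of_real (pi * (rGamma (1 + \<nu> * real n) * (- (k\<^sup>2 * s powr \<nu>)) ^ n))" for n
  proof -
    have "(1 - (- 1 - 2 * \<nu> * real n)) / 2 = 1 + \<nu> * real n" by (simp add: field_simps)
    thus ?thesis unfolding T_eq integral_mult_right_zero hankel_formula[OF a]
      by (simp only: of_real_mult mult_ac)
  qed
  have T_integrable: "integrable lborel (T n)" for n
    unfolding T_eq using integrable_hankel_kernel[OF a] by simp
  have H: "(A y)\<^sup>2 / ((A y)\<^sup>2 + of_real k ^ 2) = 1 / (1 - Q y)" for y
  proof -
    have "1 - Q y \<noteq> 0" using normQ[of y] by auto
    moreover have "(A y)\<^sup>2 * (1 - Q y) = (A y)\<^sup>2 + of_real k ^ 2"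
      using Anz[of y] by (simp add: Q_def field_simps)
    ultimately show ?thesis using Anz[of y] by (metis nonzero_divide_mult_cancel_left power_not_zero)
  qed
  have "(\<lambda>N. LINT y|lborel. (\<Sum>n<N. T n y)) \<longlonglongrightarrow>
     (LINT y|lborel. hankel_kernel (-1) a y * (1 / (1 - Q y)))"
  proof (rule integral_dominated_convergence)
    show "AE y in lborel. (\<lambda>N. \<Sum>n<N. T n y) \<longlonglongrightarrow> hankel_kernel (-1) a y * (1 / (1 - Q y))"
    proof (rule AE_I2)
      fix y
      have "norm (Q y) < 1" using normQ[of y] by simp
      from geometric_sums[OF this] show "(\<lambda>N. \<Sum>n<N. T n y) \<longlonglongrightarrow> hankel_kernel (-1) a y * (1 / (1 - Q y))"
        unfolding T_def sum_distrib_left[symmetric] sums_def by (intro tendsto_intros)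
    qed
    show "AE y in lborel. norm (\<Sum>n<N. T n y) \<le> norm (hankel_kernel (-1) a y) * 2" for N
    proof (rule AE_I2)
      fix y
      have "norm (\<Sum>n<N. Q y ^ n) \<le> (\<Sum>n<N. (1 / 2) ^ n)"
        by (rule order_trans[OF norm_sum]) (auto intro!: sum_mono power_mono normQ simp: norm_power)
      also have "\<dots> \<le> (\<Sum>n. (1 / 2 :: real) ^ n)" by (intro sum_le_suminf summable_geometric) auto
      also have "\<dots> = 2" by (subst suminf_geometric) auto
      finally show "norm (\<Sum>n<N. T n y) \<le> norm (hankel_kernel (-1) a y) * 2"
        unfolding T_def sum_distrib_left[symmetric] norm_mult by (intro mult_left_mono) auto
    qed
    show "integrable lborel (\<lambda>y. norm (hankel_kernel (-1) a y) * 2)"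
      using integrable_hankel_kernel[OF a] by simp
    show "(\<lambda>y. hankel_kernel (-1) a y * (1 / (1 - Q y))) \<in> borel_measurable lborel"
    proof -
      have "1 \<noteq> Q y" for y using normQ[of y] by auto
      hence Q1: "\<forall>y\<in>UNIV. 1 - Q y \<noteq> 0" by simp
      have "continuous_on UNIV A" unfolding A_def Complex_conv
        by (intro continuous_intros) (use a in \<open>auto simp: complex_eq_iff\<close>)
      hence "continuous_on UNIV Q" unfolding Q_def by (intro continuous_intros) (use Anz in auto)
      hence "continuous_on UNIV (\<lambda>y. hankel_kernel (-1) a y * (1 / (1 - Q y)))"
        by (intro continuous_on_mult continuous_on_divide continuous_on_diff continuous_on_const
              continuous_on_hankel_kernel continuous_on_id Q1) (use a in auto)
      thus ?thesis by (auto intro: borel_measurable_continuous_onI)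
    qed
    show "(\<lambda>y. \<Sum>n<N. T n y) \<in> borel_measurable lborel" for N
      using T_integrable by (intro borel_measurable_sum) (auto intro: borel_measurable_integrable)
  qed
  hence lim: "(\<lambda>N. of_real (\<Sum>n<N. pi * (rGamma (1 + \<nu> * real n) * (- (k\<^sup>2 * s powr \<nu>)) ^ n))) \<longlonglongrightarrow>
     (LINT y|lborel. hankel_kernel (-1) a y * (1 / (1 - Q y)))" (is "_ \<longlonglongrightarrow> ?L")
    using T_integrable by (simp only: Bochner_Integration.integral_sum T_int of_real_sum)
  have "summable (\<lambda>n. rGamma (1 + \<nu> * real n) * (- (k\<^sup>2 * s powr \<nu>)) ^ n)"
    by (rule summable_norm_cancel[OF summable_mittag_leffler[OF nu(1)]])
  hence "(\<lambda>n. pi * (rGamma (1 + \<nu> * real n) * (- (k\<^sup>2 * s powr \<nu>)) ^ n)) sums (pi * mittag_leffler \<nu> (- (k\<^sup>2 * s powr \<nu>)))"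
    unfolding mittag_leffler_def by (intro sums_mult summable_sums)
  hence "(\<lambda>N. of_real (\<Sum>n<N. pi * (rGamma (1 + \<nu> * real n) * (- (k\<^sup>2 * s powr \<nu>)) ^ n))) \<longlonglongrightarrow>
     complex_of_real (pi * mittag_leffler \<nu> (- (k\<^sup>2 * s powr \<nu>)))"
    unfolding sums_def by (intro tendsto_of_real)
  from LIMSEQ_unique[OF lim this] have "?L = of_real (pi * mittag_leffler \<nu> (- (k\<^sup>2 * s powr \<nu>)))" .
  moreover have "Complex a y powr of_real \<nu> * of_real (s powr - (\<nu> / 2)) = A y" for y
    by (simp add: A_def)
  ultimately show ?thesis
    unfolding fourier_wright_MM_hankel(2)[OF nu a s] H by (simp add: H)
qed

lemma integrable_wright_MM:
  assumes "0 < \<nu>" "\<nu> < 1" "s > 0"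
  shows "integrable lborel (\<lambda>x. 1 / 2 * wright_MM (\<nu> / 2) \<bar>x\<bar> s)"
  using fourier_wright_MM_hankel(1)[OF assms(1,2) zero_less_one assms(3), of 0]
  by (simp add: complex_of_real_integrable_eq del: of_real_mult of_real_divide)

section \<open>The Caputo derivative of the Mittag-Leffler function\<close>

text \<open>The integral of exp(-\<beta> \<tau>) over \<tau> from 0 to t, that is, the function with
  respect to which the Caputo derivative is taken, normalised to vanish at 0.\<close>

definition dodson_time :: "real \<Rightarrow> real \<Rightarrow> real" where
  "dodson_time \<beta> t = (1 - exp (- \<beta> * t)) / \<beta>"

lemma dodson_time_0 [simp]: "dodson_time \<beta> 0 = 0"
  by (simp add: dodson_time_def)

lemma dodson_time_diff: "(exp (- \<beta> * x) - exp (- \<beta> * y)) / \<beta> = dodson_time \<beta> y - dodson_time \<beta> x"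
  by (simp add: dodson_time_def diff_divide_distrib)

lemma dodson_time_less:
  assumes "\<beta> > 0" "x < y"
  shows "dodson_time \<beta> x < dodson_time \<beta> y"
  using assms by (simp add: dodson_time_def divide_strict_right_mono)

lemma dodson_time_pos: "\<beta> > 0 \<Longrightarrow> t > 0 \<Longrightarrow> dodson_time \<beta> t > 0"
  using dodson_time_less[of \<beta> 0 t] by simp

lemma DERIV_dodson_time:
  assumes "\<beta> > 0"
  shows "(dodson_time \<beta> has_field_derivative exp (- \<beta> * t)) (at t within S)"
  unfolding dodson_time_def[abs_def] using assms by (auto intro!: derivative_eq_intros)

lemma continuous_on_dodson_time: "\<beta> > 0 \<Longrightarrow> continuous_on S (dodson_time \<beta>)"
  unfolding dodson_time_def[abs_def] by (intro continuous_intros) auto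

lemma borel_measurable_dodson_time [measurable]: "dodson_time \<beta> \<in> borel_measurable borel"
  unfolding dodson_time_def[abs_def] by measurable

text \<open>Euler's Beta integral pulled back along \<open>\<phi>\<close>, the clock rescaled to map
  the interval onto (0,1). It evaluates the operator on powers of the clock, Abel's kernel, and the
  iterated Volterra bounds.\<close>

lemma has_bochner_integral_dodson_Beta:
  assumes \<beta>: "\<beta> > 0" and pq: "p > 0" "q > 0" and ab: "a < b"
  shows "has_bochner_integral lborel
    (\<lambda>y. indicator {a<..<b} y *\<^sub>R ((dodson_time \<beta> b - dodson_time \<beta> y) powr (p - 1) *
       (dodson_time \<beta> y - dodson_time \<beta> a) powr (q - 1) * exp (- \<beta> * y)))
    ((dodson_time \<beta> b - dodson_time \<beta> a) powr (p + q - 1) * Beta p q)"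
proof -
  define s where "s = dodson_time \<beta>"
  define D where "D = s b - s a"
  have D: "D > 0" using dodson_time_less[OF \<beta> ab] by (simp add: D_def s_def)
  define \<phi> where "\<phi> = (\<lambda>y. (s y - s a) / D)"
  let ?f = "\<lambda>t::real. t powr (q - 1) * (1 - t) powr (p - 1)"
  let ?h = "\<lambda>y. \<bar>exp (- \<beta> * y) / D\<bar> * ?f (\<phi> y)"
  have deriv: "(\<phi> has_field_derivative exp (- \<beta> * y) / D) (at y within S)" for y S
    unfolding \<phi>_def s_def using D by (auto intro!: derivative_eq_intros DERIV_dodson_time[OF \<beta>])
  have mono: "\<phi> x < \<phi> y" if "x < y" for x y
    using dodson_time_less[OF \<beta> that] D by (simp add: \<phi>_def s_def divide_strict_right_mono)
  have \<phi>ab: "\<phi> a = 0" "\<phi> b = 1" using D by (auto simp: \<phi>_def D_def)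
  have inj: "inj_on \<phi> S" for S
    using mono by (intro inj_onI) (metis less_irrefl linorder_neqE_linordered_idom)
  have img: "\<phi> ` {a<..<b} = {0<..<1}"
  proof (intro equalityI subsetI)
    fix t assume "t \<in> \<phi> ` {a<..<b}"
    thus "t \<in> {0<..<1}" using mono \<phi>ab by force
  next
    fix t :: real assume t: "t \<in> {0<..<1}"
    have "continuous_on {a..b} \<phi>"
      unfolding \<phi>_def s_def using D by (intro continuous_intros continuous_on_dodson_time \<beta>) auto
    then obtain x where x: "a \<le> x" "x \<le> b" "\<phi> x = t"
      using IVT'[of \<phi> a t b] t \<phi>ab ab by auto
    moreover have "x \<noteq> a" "x \<noteq> b" using x t \<phi>ab by auto
    ultimately show "t \<in> \<phi> ` {a<..<b}" by (intro image_eqI[of _ _ x]) auto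
  qed
  have B: "(?f has_integral Beta p q) {0<..<1}"
    using has_integral_Beta_real[OF pq(2,1)] by (simp add: has_integral_Icc_iff_Ioo Beta_commute)
  hence "?f absolutely_integrable_on {0<..<1}"
    by (intro nonnegative_absolutely_integrable_1) (auto simp: has_integral_integrable)
  hence "?f absolutely_integrable_on \<phi> ` {a<..<b} \<and> integral (\<phi> ` {a<..<b}) ?f = Beta p q"
    using B by (simp add: img integral_unique)
  hence h: "?h absolutely_integrable_on {a<..<b} \<and> integral {a<..<b} ?h = Beta p q"
    by (subst has_absolute_integral_change_of_variables_1'[OF _ deriv inj]) auto
  have hl: "set_integrable lborel {a<..<b} ?h"
    using h unfolding set_integrable_def
    by (subst (asm) integrable_completion) (auto simp: \<phi>_def s_def)
  have "(LINT y:{a<..<b}|lborel. ?h y) = Beta p q"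
    unfolding set_borel_integral_eq_integral(2)[OF hl] using h by (rule conjunct2)
  \<comment> \<open>Undoing the rescaling costs \<open>D powr (p - 1)\<close> and
    \<open>D powr (q - 1)\<close> for the two powers and one more \<open>D\<close> for the
    differential.\<close>
  hence "has_bochner_integral lborel (\<lambda>y. D powr (p + q - 1) * (indicator {a<..<b} y *\<^sub>R ?h y)) (D powr (p + q - 1) * Beta p q)"
    using hl by (intro has_bochner_integral_mult_right)
      (simp add: has_bochner_integral_iff set_integrable_def set_lebesgue_integral_def)
  also have "(\<lambda>y. D powr (p + q - 1) * (indicator {a<..<b} y *\<^sub>R ?h y)) =
     (\<lambda>y. indicator {a<..<b} y *\<^sub>R ((s b - s y) powr (p - 1) * (s y - s a) powr (q - 1) * exp (- \<beta> * y)))"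
  proof
    fix y
    show "D powr (p + q - 1) * (indicator {a<..<b} y *\<^sub>R ?h y) =
       indicator {a<..<b} y *\<^sub>R ((s b - s y) powr (p - 1) * (s y - s a) powr (q - 1) * exp (- \<beta> * y))"
    proof (cases "y \<in> {a<..<b}")
      case True
      hence pos: "s y - s a > 0" "s b - s y > 0"
        using dodson_time_less[OF \<beta>] by (auto simp: s_def)
      have "1 - \<phi> y = (s b - s y) / D" using D by (simp add: \<phi>_def D_def field_simps)
      hence "?f (\<phi> y) = (s y - s a) powr (q - 1) / D powr (q - 1) * ((s b - s y) powr (p - 1) / D powr (p - 1))"
        using pos D by (simp add: \<phi>_def powr_divide)
      moreover have "D powr (p + q - 1) = D powr (q - 1) * D powr (p - 1) * D"
      proof -
        have "p + q - 1 = (q - 1) + (p - 1) + 1" by simp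
        hence "D powr (p + q - 1) = D powr (q - 1) * D powr (p - 1) * D powr 1"
          by (simp only: powr_add)
        thus ?thesis using D by simp
      qed
      ultimately show ?thesis using True D by (simp add: field_simps)
    qed auto
  qed
  finally show ?thesis unfolding s_def D_def .
qed

section \<open>The Mittag-Leffler function as an eigenfunction\<close>

text \<open>Termwise differentiation of an everywhere convergent power series, followed by the chain
  rule. The constant term drops out, hence the shift from n to n + 1; the factor
  \<open>\<nu> * (real n + 1)\<close> is absorbed by the functional equation of
  \<open>rGamma\<close>.\<close>

lemma mittag_leffler_deriv_powr:
  fixes c x \<nu> :: real
  assumes nu: "0 < \<nu>" and x: "x > 0"
  defines "T \<equiv> \<lambda>n. c ^ Suc n * rGamma (\<nu> * (real n + 1)) * x powr (\<nu> * (real n + 1) - 1)"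
  shows "summable T"
    and "((\<lambda>x. mittag_leffler \<nu> (c * x powr \<nu>)) has_field_derivative (\<Sum>n. T n)) (at x)"
proof -
  define a where "a = (\<lambda>n. rGamma (1 + \<nu> * real n))"
  have sm: "summable (\<lambda>n. a n * y ^ n)" for y
    unfolding a_def by (rule summable_norm_cancel[OF summable_mittag_leffler[OF nu]])
  have T_eq: "T = (\<lambda>n. (c * (\<nu> * x powr (\<nu> - 1))) * (diffs a n * (c * x powr \<nu>) ^ n))"
  proof
    fix n
    have "rGamma (\<nu> * (real n + 1)) = \<nu> * (real n + 1) * a (Suc n)"
      using rGamma_plus1[of "\<nu> * (real n + 1)"] by (simp add: a_def add_ac mult_ac)
    moreover have "x powr (\<nu> * (real n + 1) - 1) = x powr (\<nu> - 1) * (x powr \<nu>) ^ n"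
    proof -
      have "(x powr \<nu>) ^ n = x powr (\<nu> * real n)" using x by (simp add: powr_realpow[symmetric] powr_powr)
      moreover have "\<nu> * (real n + 1) - 1 = (\<nu> - 1) + \<nu> * real n" by (simp add: algebra_simps)
      ultimately show ?thesis by (simp only: powr_add)
    qed
    ultimately show "T n = (c * (\<nu> * x powr (\<nu> - 1))) * (diffs a n * (c * x powr \<nu>) ^ n)"
      by (simp add: T_def diffs_def power_mult_distrib algebra_simps)
  qed
  have sd: "summable (\<lambda>n. diffs a n * y ^ n)" for y
    by (rule termdiff_converges_all) (rule sm)
  show "summable T" unfolding T_eq by (intro summable_mult sd)
  have "(mittag_leffler \<nu> has_field_derivative (\<Sum>n. diffs a n * (c * x powr \<nu>) ^ n)) (at (c * x powr \<nu>))"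
    using termdiffs_strong_converges_everywhere[OF sm, of "c * x powr \<nu>"]
    unfolding mittag_leffler_def[abs_def] a_def .
  moreover have "((\<lambda>x. c * x powr \<nu>) has_field_derivative c * (\<nu> * x powr (\<nu> - 1))) (at x)"
    using x by (auto intro!: derivative_eq_intros)
  ultimately have "((\<lambda>x. mittag_leffler \<nu> (c * x powr \<nu>)) has_field_derivative
      (\<Sum>n. diffs a n * (c * x powr \<nu>) ^ n) * (c * (\<nu> * x powr (\<nu> - 1)))) (at x)"
    by (rule DERIV_chain2)
  also have "(\<Sum>n. diffs a n * (c * x powr \<nu>) ^ n) * (c * (\<nu> * x powr (\<nu> - 1))) = (\<Sum>n. T n)"
    unfolding T_eq by (subst suminf_mult[OF sd]) (simp add: mult_ac)
  finally show "((\<lambda>x. mittag_leffler \<nu> (c * x powr \<nu>)) has_field_derivative (\<Sum>n. T n)) (at x)" .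
qed

lemma rGamma_pos: "x > 0 \<Longrightarrow> rGamma (x :: real) > 0"
  by (simp add: rGamma_inverse_Gamma Gamma_real_pos)

text \<open>The Beta integral sends the derivative of term n + 1 of the series to
  \<open>c * Gamma (1 - \<nu>)\<close> times term n, so the operator acts as multiplication by
  \<open>c\<close>. The formula for \<open>g\<close> is assumed at positive times only, since a
  Fourier transform in \<open>x\<close> is known only there.\<close>

lemma caputo_dodson_mittag_leffler:
  assumes \<beta>: "\<beta> > 0" and nu: "0 < \<nu>" "\<nu> < 1" and t: "t > 0"
    and g: "\<And>\<tau>. \<tau> > 0 \<Longrightarrow> g \<tau> = complex_of_real (mittag_leffler \<nu> (c * dodson_time \<beta> \<tau> powr \<nu>))"
  shows "caputo_dodson_exists \<beta> \<nu> g t" and "caputo_dodson \<beta> \<nu> g t = of_real c * g t"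
proof -
  define s where "s = dodson_time \<beta>"
  have s: "s \<tau> > 0" if "\<tau> > 0" for \<tau> using dodson_time_pos[OF \<beta> that] by (simp add: s_def)
  define T where "T = (\<lambda>c \<tau> n. c ^ Suc n * rGamma (\<nu> * (real n + 1)) * s \<tau> powr (\<nu> * (real n + 1) - 1))"
  define d where "d = (\<lambda>\<tau>. (\<Sum>n. T c \<tau> n) * exp (- \<beta> * \<tau>))"
  have T_summable: "summable (T c' \<tau>)" if "\<tau> > 0" for c' \<tau>
    unfolding T_def by (rule mittag_leffler_deriv_powr(1)[OF nu(1) s[OF that]])
  have deriv: "(g has_vector_derivative of_real (d \<tau>)) (at \<tau>)" if \<tau>: "\<tau> > 0" for \<tau>
  proof -
    have "((\<lambda>\<tau>. mittag_leffler \<nu> (c * s \<tau> powr \<nu>)) has_field_derivative d \<tau>) (at \<tau>)"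
      unfolding d_def T_def
      by (rule DERIV_chain2[where g = s and f = "\<lambda>x. mittag_leffler \<nu> (c * x powr \<nu>)",
            OF mittag_leffler_deriv_powr(2)[OF nu(1) s[OF \<tau>]]])
         (simp add: s_def DERIV_dodson_time[OF \<beta>, simplified])
    hence "((\<lambda>\<tau>. complex_of_real (mittag_leffler \<nu> (c * s \<tau> powr \<nu>))) has_vector_derivative of_real (d \<tau>)) (at \<tau>)"
      by (intro has_vector_derivative_of_real) (simp add: has_real_derivative_iff_has_vector_derivative)
    \<comment> \<open>The formula for \<open>g\<close> holds on the open half-line, which suffices
      to transfer the derivative.\<close>
    thus ?thesis
      by (rule has_vector_derivative_transform_within_open[where S = "{0<..}"]) (use \<tau> g in \<open>auto simp: s_def\<close>)
  qed
  define F where "F = (\<lambda>n \<tau>. indicator {0<..<t} \<tau> *\<^sub>R ((s t - s \<tau>) powr (- \<nu>) * (T c \<tau> n * exp (- \<beta> * \<tau>))))"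
  \<comment> \<open>The coefficient \<open>c'\<close> is free because the integral is taken with
    \<open>c\<close> for the value and with \<open>\<bar>c\<bar>\<close> for the norms, which
    justify termwise integration.\<close>
  have F_int: "has_bochner_integral lborel (\<lambda>\<tau>. indicator {0<..<t} \<tau> *\<^sub>R ((s t - s \<tau>) powr (- \<nu>) * (T c' \<tau> n * exp (- \<beta> * \<tau>))))
     (c' * Gamma (1 - \<nu>) * (rGamma (1 + \<nu> * real n) * (c' * s t powr \<nu>) ^ n))" for c' n
  proof -
    let ?q = "\<nu> * (real n + 1)"
    have q: "?q > 0" using nu by (intro mult_pos_pos) auto
    have "has_bochner_integral lborel (\<lambda>\<tau>. (c' ^ Suc n * rGamma ?q) *
        (indicator {0<..<t} \<tau> *\<^sub>R ((s t - s \<tau>) powr ((1 - \<nu>) - 1) * (s \<tau> - s 0) powr (?q - 1) * exp (- \<beta> * \<tau>))))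
      ((c' ^ Suc n * rGamma ?q) * ((s t - s 0) powr ((1 - \<nu>) + ?q - 1) * Beta (1 - \<nu>) ?q))"
      unfolding s_def using nu q
      by (intro has_bochner_integral_mult_right has_bochner_integral_dodson_Beta \<beta> t) auto
    also have "(\<lambda>\<tau>. (c' ^ Suc n * rGamma ?q) *
        (indicator {0<..<t} \<tau> *\<^sub>R ((s t - s \<tau>) powr ((1 - \<nu>) - 1) * (s \<tau> - s 0) powr (?q - 1) * exp (- \<beta> * \<tau>)))) =
      (\<lambda>\<tau>. indicator {0<..<t} \<tau> *\<^sub>R ((s t - s \<tau>) powr (- \<nu>) * (T c' \<tau> n * exp (- \<beta> * \<tau>))))"
      by (auto simp: fun_eq_iff T_def s_def mult_ac)
    also have "(c' ^ Suc n * rGamma ?q) * ((s t - s 0) powr ((1 - \<nu>) + ?q - 1) * Beta (1 - \<nu>) ?q) =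
       c' * Gamma (1 - \<nu>) * (rGamma (1 + \<nu> * real n) * (c' * s t powr \<nu>) ^ n)"
    proof -
      have "rGamma ?q * Gamma ?q = 1" using rGamma_pos[OF q] by (simp add: Gamma_def)
      hence "rGamma ?q * Beta (1 - \<nu>) ?q = Gamma (1 - \<nu>) * rGamma ((1 - \<nu>) + ?q)"
        by (simp add: Beta_altdef mult_ac)
      moreover have "(1 - \<nu>) + ?q = 1 + \<nu> * real n" by (simp add: algebra_simps)
      moreover have "(s t - s 0) powr ((1 - \<nu>) + ?q - 1) = (s t powr \<nu>) ^ n"
      proof -
        have "(1 - \<nu>) + ?q - 1 = \<nu> * real n" by (simp add: algebra_simps)
        thus ?thesis using s[OF t] by (simp add: powr_realpow[symmetric] powr_powr s_def)
      qed
      ultimately show ?thesis by (simp add: power_mult_distrib mult_ac)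
    qed
    finally show ?thesis .
  qed
  have F_integrable: "integrable lborel (F n)" for n
    unfolding F_def using F_int[of c n] by (rule integrable.intros)
  have normF: "norm (F n \<tau>) = indicator {0<..<t} \<tau> *\<^sub>R ((s t - s \<tau>) powr (- \<nu>) * (T \<bar>c\<bar> \<tau> n * exp (- \<beta> * \<tau>)))" for n \<tau>
    using nu rGamma_pos[of "\<nu> * (real n + 1)"] mult_pos_pos[of \<nu> "real n + 1"]
    by (auto simp: F_def T_def abs_mult power_abs indicator_def)
  have sm_ae: "AE \<tau> in lborel. summable (\<lambda>n. norm (F n \<tau>))"
  proof (rule AE_I2)
    fix \<tau>
    show "summable (\<lambda>n. norm (F n \<tau>))"
      unfolding normF by (cases "\<tau> \<in> {0<..<t}") (auto intro!: summable_mult summable_mult2 T_summable)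
  qed
  have sm_int: "summable (\<lambda>n. LINT \<tau>|lborel. norm (F n \<tau>))"
    unfolding normF has_bochner_integral_integral_eq[OF F_int]
    by (intro summable_mult summable_norm_cancel[OF summable_mittag_leffler[OF nu(1)]])
  have sumF: "(\<Sum>n. F n \<tau>) = indicator {0<..<t} \<tau> *\<^sub>R ((s t - s \<tau>) powr (- \<nu>) * d \<tau>)" for \<tau>
  proof (cases "\<tau> \<in> {0<..<t}")
    case True
    hence "\<tau> > 0" by simp
    thus ?thesis using True
      by (simp add: F_def d_def suminf_mult summable_mult2 T_summable suminf_mult2[symmetric])
  qed (auto simp: F_def)
  have int: "integrable lborel (\<lambda>\<tau>. indicator {0<..<t} \<tau> *\<^sub>R ((s t - s \<tau>) powr (- \<nu>) * d \<tau>))"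
    using integrable_suminf[OF F_integrable sm_ae sm_int] unfolding sumF .
  have val: "(LINT \<tau>|lborel. indicator {0<..<t} \<tau> *\<^sub>R ((s t - s \<tau>) powr (- \<nu>) * d \<tau>)) =
     c * Gamma (1 - \<nu>) * mittag_leffler \<nu> (c * s t powr \<nu>)"
  proof -
    have "(LINT \<tau>|lborel. F n \<tau>) = c * Gamma (1 - \<nu>) * (rGamma (1 + \<nu> * real n) * (c * s t powr \<nu>) ^ n)" for n
      unfolding F_def by (rule has_bochner_integral_integral_eq[OF F_int])
    thus ?thesis
      using integral_suminf[OF F_integrable sm_ae sm_int]
      by (simp only: sumF mittag_leffler_def suminf_mult[OF summable_norm_cancel[OF summable_mittag_leffler[OF nu(1)]]])
  qed
  have eq: "indicator {0<..<t} \<tau> *\<^sub>R caputo_dodson_integrand \<beta> \<nu> g t \<tau> =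
     complex_of_real (indicator {0<..<t} \<tau> *\<^sub>R ((s t - s \<tau>) powr (- \<nu>) * d \<tau>))" for \<tau>
    using vector_derivative_at[OF deriv, of \<tau>]
    by (auto simp: caputo_dodson_integrand_def dodson_time_diff[simplified] s_def indicator_def scaleR_conv_of_real)
  show "caputo_dodson_exists \<beta> \<nu> g t"
    unfolding caputo_dodson_exists_def set_integrable_def eq
  proof
    show "\<forall>\<tau>\<in>{0<..<t}. g differentiable at \<tau>"
      by (auto intro!: differentiableI_vector[OF deriv])
    show "integrable lborel (\<lambda>\<tau>. complex_of_real (indicator {0<..<t} \<tau> *\<^sub>R ((s t - s \<tau>) powr (- \<nu>) * d \<tau>)))"
      using int by (simp only: complex_of_real_integrable_eq)
  qed
  have "Gamma (1 - \<nu>) > 0" using nu by (intro Gamma_real_pos) auto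
  thus "caputo_dodson \<beta> \<nu> g t = of_real c * g t"
    unfolding caputo_dodson_def set_lebesgue_integral_def eq integral_complex_of_real val g[OF t]
    by (simp add: s_def scaleR_conv_of_real)
qed

section \<open>Uniqueness\<close>

text \<open>Multiplying the Caputo integrand by the \<open>\<nu>\<close>-th power of the clock
  difference removes the weight, and this factor is bounded by
  \<open>s t powr \<nu>\<close>.\<close>

lemma set_integrable_vector_derivative:
  assumes \<beta>: "\<beta> > 0" and nu: "0 < \<nu>" and ex: "caputo_dodson_exists \<beta> \<nu> g t"
  shows "set_integrable lborel {0<..<t} (\<lambda>\<tau>. vector_derivative g (at \<tau>))"
proof -
  define s where "s = dodson_time \<beta>"
  define F where "F = (\<lambda>\<tau>. indicator {0<..<t} \<tau> *\<^sub>R caputo_dodson_integrand \<beta> \<nu> g t \<tau>)"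
  have F: "integrable lborel F"
    using ex by (simp add: F_def caputo_dodson_exists_def set_integrable_def)
  hence [measurable]: "F \<in> borel_measurable borel" by (auto dest: borel_measurable_integrable)
  have [measurable]: "s \<in> borel_measurable borel" by (simp add: s_def)
  have eq: "indicator {0<..<t} \<tau> *\<^sub>R vector_derivative g (at \<tau>) =
      (indicator {0<..<t} \<tau> * (s t - s \<tau>) powr \<nu>) *\<^sub>R F \<tau>" for \<tau>
  proof (cases "\<tau> \<in> {0<..<t}")
    case True
    hence "s t - s \<tau> > 0" using dodson_time_less[OF \<beta>, of \<tau> t] by (simp add: s_def)
    hence "(s t - s \<tau>) powr \<nu> * (s t - s \<tau>) powr (- \<nu>) = 1"
      by (simp add: powr_minus)
    thus ?thesis using True
      by (simp add: F_def caputo_dodson_integrand_def dodson_time_diff[simplified] s_def)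
  qed auto
  show ?thesis unfolding set_integrable_def eq
  proof (rule Bochner_Integration.integrable_bound)
    show "integrable lborel (\<lambda>\<tau>. s t powr \<nu> *\<^sub>R F \<tau>)" using F by simp
    show "AE \<tau> in lborel. norm ((indicator {0<..<t} \<tau> * (s t - s \<tau>) powr \<nu>) *\<^sub>R F \<tau>) \<le> norm (s t powr \<nu> *\<^sub>R F \<tau>)"
    proof (rule AE_I2)
      fix \<tau>
      show "norm ((indicator {0<..<t} \<tau> * (s t - s \<tau>) powr \<nu>) *\<^sub>R F \<tau>) \<le> norm (s t powr \<nu> *\<^sub>R F \<tau>)"
      proof (cases "\<tau> \<in> {0<..<t}")
        case True
        hence "0 \<le> s t - s \<tau>" "s t - s \<tau> \<le> s t"
          using dodson_time_less[OF \<beta>, of \<tau> t] dodson_time_pos[OF \<beta>, of \<tau>] by (auto simp: s_def)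
        hence "(s t - s \<tau>) powr \<nu> \<le> s t powr \<nu>" using nu by (intro powr_mono2) auto
        thus ?thesis using True by (simp add: mult_right_mono)
      qed auto
    qed
  qed measurable
qed

text \<open>The fundamental theorem of calculus on \<open>{e..t}\<close>, with \<open>e\<close>
  tending to 0 by dominated convergence. Existence is required at time \<open>t + 1\<close> because
  it yields differentiability only strictly before that time, and \<open>t\<close> itself has to be
  included.\<close>

lemma integral_vector_derivative_from_0:
  assumes \<beta>: "\<beta> > 0" and nu: "0 < \<nu>" and t: "t > 0"
    and ex: "caputo_dodson_exists \<beta> \<nu> g (t + 1)" and lim: "(g \<longlongrightarrow> 0) (at_right 0)"
  shows "(LINT \<tau>|lborel. indicator {0<..<t} \<tau> *\<^sub>R vector_derivative g (at \<tau>)) = g t"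
proof -
  define D where "D = (\<lambda>\<tau>. vector_derivative g (at \<tau>))"
  have D: "set_integrable lborel {0<..<t + 1} D"
    unfolding D_def by (rule set_integrable_vector_derivative[OF \<beta> nu ex])
  have deriv: "(g has_vector_derivative D \<tau>) (at \<tau>)" if "0 < \<tau>" "\<tau> < t + 1" for \<tau>
    using ex that by (simp add: D_def caputo_dodson_exists_def vector_derivative_works[symmetric])
  have sub: "set_integrable lborel S D" if "S \<in> sets lborel" "S \<subseteq> {0<..<t + 1}" for S
    by (rule set_integrable_subset[OF D that])
  hence subi: "integrable lborel (\<lambda>\<tau>. indicator S \<tau> *\<^sub>R D \<tau>)" if "S \<in> sets lborel" "S \<subseteq> {0<..<t + 1}" for S
    using that by (simp add: set_integrable_def)
  have FTC: "(LINT \<tau>:{e..t}|lborel. D \<tau>) = g t - g e" if "0 < e" "e \<le> t" for e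
  proof -
    have "(D has_integral (g t - g e)) {e..t}"
      by (rule fundamental_theorem_of_calculus) (use that deriv in \<open>auto intro: has_vector_derivative_at_within\<close>)
    moreover have "{e..t} \<subseteq> {0<..<t + 1}" using that by auto
    ultimately show ?thesis
      using set_borel_integral_eq_integral(2)[OF sub[of "{e..t}"]] by (simp add: integral_unique)
  qed
  define e where "e = (\<lambda>n::nat. t / (real n + 1))"
  have e: "0 < e n" "e n \<le> t" for n using t by (auto simp: e_def field_simps)
  have e0: "e \<longlonglongrightarrow> 0" unfolding e_def by real_asymp
  hence eright: "filterlim e (at_right 0) sequentially"
    using e(1) by (auto simp: filterlim_at less_imp_neq[symmetric] intro!: always_eventually)
  have "(\<lambda>n. LINT \<tau>|lborel. indicator {e n..t} \<tau> *\<^sub>R D \<tau>) \<longlonglongrightarrow> (LINT \<tau>|lborel. indicator {0<..t} \<tau> *\<^sub>R D \<tau>)"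
  proof (rule integral_dominated_convergence)
    show "integrable lborel (\<lambda>\<tau>. norm (indicator {0<..t} \<tau> *\<^sub>R D \<tau>))"
      by (intro integrable_norm subi) auto
    show "(\<lambda>\<tau>. indicator {0<..t} \<tau> *\<^sub>R D \<tau>) \<in> borel_measurable lborel"
      by (intro borel_measurable_integrable subi) auto
    show "(\<lambda>\<tau>. indicator {e n..t} \<tau> *\<^sub>R D \<tau>) \<in> borel_measurable lborel" for n
      by (intro borel_measurable_integrable subi) (use e(1)[of n] in auto)
    show "AE \<tau> in lborel. norm (indicator {e n..t} \<tau> *\<^sub>R D \<tau>) \<le> norm (indicator {0<..t} \<tau> *\<^sub>R D \<tau>)" for n
      using e(1)[of n] by (auto simp: indicator_def)
    show "AE \<tau> in lborel. (\<lambda>n. indicator {e n..t} \<tau> *\<^sub>R D \<tau>) \<longlonglongrightarrow> indicator {0<..t} \<tau> *\<^sub>R D \<tau>"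
    proof (rule AE_I2)
      fix \<tau>
      have "\<forall>\<^sub>F n in sequentially. indicator {e n..t} \<tau> *\<^sub>R D \<tau> = indicator {0<..t} \<tau> *\<^sub>R D \<tau>"
      proof (cases "\<tau> > 0")
        case True
        have "\<forall>\<^sub>F n in sequentially. e n < \<tau>" by (rule order_tendstoD(2)[OF e0 True])
        thus ?thesis by eventually_elim (use True in \<open>auto simp: indicator_def\<close>)
      next
        case False
        hence "\<not> e n \<le> \<tau>" for n using e(1)[of n] by linarith
        thus ?thesis using False by (simp add: indicator_def)
      qed
      thus "(\<lambda>n. indicator {e n..t} \<tau> *\<^sub>R D \<tau>) \<longlonglongrightarrow> indicator {0<..t} \<tau> *\<^sub>R D \<tau>"
        by (rule tendsto_eventually)
    qed
  qed
  moreover have "(LINT \<tau>|lborel. indicator {e n..t} \<tau> *\<^sub>R D \<tau>) = g t - g (e n)" for n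
    using FTC[OF e] by (simp add: set_lebesgue_integral_def)
  moreover have "(\<lambda>n. g t - g (e n)) \<longlonglongrightarrow> g t - 0"
    by (intro tendsto_intros filterlim_compose[OF lim eright])
  ultimately have "(LINT \<tau>|lborel. indicator {0<..t} \<tau> *\<^sub>R D \<tau>) = g t"
    using LIMSEQ_unique by fastforce
  moreover have "(LINT \<tau>|lborel. indicator {0<..t} \<tau> *\<^sub>R D \<tau>) = (LINT \<tau>|lborel. indicator {0<..<t} \<tau> *\<^sub>R D \<tau>)"
  proof (rule integral_cong_AE)
    show "AE \<tau> in lborel. indicator {0<..t} \<tau> *\<^sub>R D \<tau> = indicator {0<..<t} \<tau> *\<^sub>R D \<tau>"
      using AE_lborel_singleton[of t] by eventually_elim (auto simp: indicator_def)
  qed (intro borel_measurable_integrable subi; auto)+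
  ultimately show ?thesis by (simp add: D_def)
qed

text \<open>Abel's trick: applying the fractional integral of order \<open>\<nu>\<close> to the equation cancels the
  Caputo derivative and leaves a weakly singular Volterra equation.\<close>

lemma caputo_dodson_Volterra:
  assumes \<beta>: "\<beta> > 0" and nu: "0 < \<nu>" "\<nu> < 1" and t: "t > 0"
    and ex: "\<And>t. t > 0 \<Longrightarrow> caputo_dodson_exists \<beta> \<nu> g t"
    and eq: "\<And>t. t > 0 \<Longrightarrow> caputo_dodson \<beta> \<nu> g t = of_real c * g t"
    and lim: "(g \<longlongrightarrow> 0) (at_right 0)"
  defines "f \<equiv> \<lambda>y. indicator {0<..<t} y *\<^sub>R
      (((dodson_time \<beta> t - dodson_time \<beta> y) powr (\<nu> - 1) * exp (- \<beta> * y)) *\<^sub>R g y)"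
  shows "integrable lborel (\<lambda>y. of_real c * f y)" "of_real (Gamma \<nu>) * g t = (LINT y|lborel. of_real c * f y)"
proof -
  define s where "s = dodson_time \<beta>"
  have [measurable]: "s \<in> borel_measurable borel" by (simp add: s_def)
  have s: "s x < s y" if "x < y" for x y using dodson_time_less[OF \<beta> that] by (simp add: s_def)
  define D where "D = (\<lambda>\<tau>. indicator {0<..<t} \<tau> *\<^sub>R vector_derivative g (at \<tau>))"
  have D: "integrable lborel D"
    using set_integrable_vector_derivative[OF \<beta> nu(1) ex[OF t]] by (simp add: D_def set_integrable_def)
  have [measurable]: "D \<in> borel_measurable borel" using D by (auto dest: borel_measurable_integrable)
  \<comment> \<open>Abel's kernel on the triangle of pairs with \<tau> < y < t. The exponents
    \<open>\<nu> - 1\<close> and \<open>- \<nu>\<close> are such that its integral over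
    \<open>y\<close> is a Beta value independent of both \<open>\<tau>\<close> and
    \<open>t\<close>.\<close>
  define w where "w = (\<lambda>\<tau> y. if 0 < \<tau> \<and> \<tau> < y \<and> y < t then
     (s t - s y) powr (\<nu> - 1) * (s y - s \<tau>) powr (- \<nu>) * exp (- \<beta> * y) else 0)"
  have w_nonneg: "w \<tau> y \<ge> 0" for \<tau> y by (simp add: w_def)
  have w_int: "has_bochner_integral lborel (\<lambda>y. w \<tau> y) (Beta \<nu> (1 - \<nu>))" if "\<tau> \<in> {0<..<t}" for \<tau>
  proof -
    have "has_bochner_integral lborel
    (\<lambda>y. indicator {\<tau><..<t} y *\<^sub>R ((s t - s y) powr (\<nu> - 1) *
       (s y - s \<tau>) powr ((1 - \<nu>) - 1) * exp (- \<beta> * y)))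
    ((s t - s \<tau>) powr (\<nu> + (1 - \<nu>) - 1) * Beta \<nu> (1 - \<nu>))"
      unfolding s_def using that nu by (intro has_bochner_integral_dodson_Beta \<beta>) auto
    also have "(s t - s \<tau>) powr (\<nu> + (1 - \<nu>) - 1) * Beta \<nu> (1 - \<nu>) = Beta \<nu> (1 - \<nu>)"
      using s[of \<tau> t] that by simp
    also have "(\<lambda>y. indicator {\<tau><..<t} y *\<^sub>R ((s t - s y) powr (\<nu> - 1) *
       (s y - s \<tau>) powr ((1 - \<nu>) - 1) * exp (- \<beta> * y))) = w \<tau>"
      using that by (auto simp: w_def fun_eq_iff indicator_def)
    finally show ?thesis .
  qed
  have int: "integrable (lborel \<Otimes>\<^sub>M lborel) (\<lambda>(\<tau>, y). w \<tau> y *\<^sub>R D \<tau>)"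
  proof (rule lborel_pair.Fubini_integrable)
    show "(\<lambda>(\<tau>, y). w \<tau> y *\<^sub>R D \<tau>) \<in> borel_measurable (lborel \<Otimes>\<^sub>M lborel)"
      unfolding w_def by measurable
    have eq: "(LINT y|lborel. norm (case (\<tau>, y) of (\<tau>, y) \<Rightarrow> w \<tau> y *\<^sub>R D \<tau>)) = Beta \<nu> (1 - \<nu>) * norm (D \<tau>)" for \<tau>
      using has_bochner_integral_integral_eq[OF w_int, of \<tau>] w_nonneg
      by (cases "\<tau> \<in> {0<..<t}") (auto simp: D_def)
    show "integrable lborel (\<lambda>\<tau>. LINT y|lborel. norm (case (\<tau>, y) of (\<tau>, y) \<Rightarrow> w \<tau> y *\<^sub>R D \<tau>))"
      unfolding eq using D by simp
    show "AE \<tau> in lborel. integrable lborel (\<lambda>y. case (\<tau>, y) of (\<tau>, y) \<Rightarrow> w \<tau> y *\<^sub>R D \<tau>)"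
    proof (rule AE_I2)
      fix \<tau>
      show "integrable lborel (\<lambda>y. case (\<tau>, y) of (\<tau>, y) \<Rightarrow> w \<tau> y *\<^sub>R D \<tau>)"
        using integrable.intros[OF w_int, of \<tau>] by (cases "\<tau> \<in> {0<..<t}") (auto simp: D_def)
    qed
  qed
  have Gpos: "Gamma (1 - \<nu>) > 0" using nu by (intro Gamma_real_pos) auto
  \<comment> \<open>Integrating over \<open>\<tau>\<close> first reassembles the Caputo derivative
    at time \<open>y\<close>, where the equation can be used.\<close>
  have inner: "(LINT \<tau>|lborel. w \<tau> y *\<^sub>R D \<tau>) = of_real (Gamma (1 - \<nu>)) * (of_real c * f y)" for y
  proof (cases "y \<in> {0<..<t}")
    case True
    have "(LINT \<tau>|lborel. w \<tau> y *\<^sub>R D \<tau>) = (LINT \<tau>|lborel. ((s t - s y) powr (\<nu> - 1) * exp (- \<beta> * y)) *\<^sub>R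
        (indicator {0<..<y} \<tau> *\<^sub>R caputo_dodson_integrand \<beta> \<nu> g y \<tau>))"
      using True by (intro Bochner_Integration.integral_cong refl)
        (auto simp: w_def D_def caputo_dodson_integrand_def dodson_time_diff[simplified] s_def indicator_def)
    also have "\<dots> = ((s t - s y) powr (\<nu> - 1) * exp (- \<beta> * y)) *\<^sub>R
        (LINT \<tau>:{0<..<y}|lborel. caputo_dodson_integrand \<beta> \<nu> g y \<tau>)"
      unfolding set_lebesgue_integral_def by (rule integral_scaleR_right)
    also have "(LINT \<tau>:{0<..<y}|lborel. caputo_dodson_integrand \<beta> \<nu> g y \<tau>) =
        Gamma (1 - \<nu>) *\<^sub>R caputo_dodson \<beta> \<nu> g y"
      using Gpos by (simp add: caputo_dodson_def)
    also have "caputo_dodson \<beta> \<nu> g y = of_real c * g y" using True by (intro eq) auto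
    finally show ?thesis using True by (simp add: f_def s_def scaleR_conv_of_real mult_ac)
  next
    case False
    hence "w \<tau> y = 0" for \<tau> by (auto simp: w_def)
    thus ?thesis using False by (simp add: f_def)
  qed
  have outer: "(LINT y|lborel. w \<tau> y *\<^sub>R D \<tau>) = of_real (Beta \<nu> (1 - \<nu>)) * D \<tau>" for \<tau>
    using has_bochner_integral_integral_eq[OF w_int, of \<tau>] integrable.intros[OF w_int, of \<tau>]
    by (cases "\<tau> \<in> {0<..<t}") (auto simp: D_def scaleR_conv_of_real)
  \<comment> \<open>Fubini sees \<open>f\<close> only multiplied by \<open>c\<close>, so
    integrability is obtained for the product.\<close>
  have "integrable lborel (\<lambda>y. of_real (Gamma (1 - \<nu>)) * (of_real c * f y))"
    using lborel_pair.integrable_snd[OF int] unfolding inner .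
  hence "integrable lborel (\<lambda>y. of_real (1 / Gamma (1 - \<nu>)) * (of_real (Gamma (1 - \<nu>)) * (of_real c * f y)))"
    by (rule integrable_mult_right)
  thus "integrable lborel (\<lambda>y. of_real c * f y)" using Gpos by (simp add: mult.assoc[symmetric])
  have "of_real (Gamma (1 - \<nu>)) * (LINT y|lborel. of_real c * f y) =
     of_real (Beta \<nu> (1 - \<nu>)) * (LINT \<tau>|lborel. D \<tau>)"
    using lborel_pair.Fubini_integral[OF int] unfolding inner outer integral_mult_right_zero .
  also have "(LINT \<tau>|lborel. D \<tau>) = g t"
    unfolding D_def using t by (intro integral_vector_derivative_from_0[OF \<beta> nu(1) t ex lim]) auto
  also have "Beta \<nu> (1 - \<nu>) = Gamma (1 - \<nu>) * Gamma \<nu>" by (simp add: Beta_def)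
  finally show "of_real (Gamma \<nu>) * g t = (LINT y|lborel. of_real c * f y)"
    using Gpos by simp
qed

section \<open>Uniqueness for the Caputo equation\<close>

text \<open>Near 0 the limit bounds \<open>g\<close>, and on the remaining compact interval
  continuity does. The bound starts the iteration of the Volterra equation.\<close>

lemma caputo_dodson_bounded:
  assumes ex: "\<And>t. t > 0 \<Longrightarrow> caputo_dodson_exists \<beta> \<nu> g t" and lim: "(g \<longlongrightarrow> 0) (at_right 0)"
  obtains m where "\<And>t. 0 < t \<Longrightarrow> t \<le> T \<Longrightarrow> norm (g t) \<le> m"
proof -
  have "\<forall>\<^sub>F t in at_right 0. norm (g t) < 1"
    using tendstoD[OF lim, of 1] by simp
  then obtain d where d: "d > 0" "\<And>t. 0 < t \<Longrightarrow> t < d \<Longrightarrow> norm (g t) < 1"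
    by (auto simp: eventually_at_right_field)
  have "continuous_on {d..T} g"
  proof (intro continuous_at_imp_continuous_on ballI)
    fix t assume "t \<in> {d..T}"
    hence "t \<in> {0<..<t + 1}" "t + 1 > 0" using d by auto
    hence "g differentiable at t" using ex[of "t + 1"] unfolding caputo_dodson_exists_def by blast
    thus "isCont g t" by (rule differentiable_imp_continuous_within)
  qed
  hence "bounded (g ` {d..T})" by (intro compact_imp_bounded compact_continuous_image) auto
  then obtain m where "\<forall>x\<in>g ` {d..T}. norm x \<le> m" unfolding bounded_iff by blast
  hence m: "norm (g t) \<le> m" if "t \<in> {d..T}" for t using that by blast
  show ?thesis
  proof
    fix t assume "0 < t" "t \<le> T"
    thus "norm (g t) \<le> max 1 m" using d(2)[of t] m[of t] by (cases "t < d") auto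
  qed
qed

text \<open>Each insertion of a bound into the Volterra equation turns a multiple of one term of the
  Mittag-Leffler series at \<open>\<bar>c\<bar> * s t powr \<nu>\<close> into the same multiple of
  the next. The series converges, so its terms, and with them \<open>g\<close>, are forced to
  0.\<close>

lemma caputo_dodson_eq_0:
  assumes \<beta>: "\<beta> > 0" and nu: "0 < \<nu>" "\<nu> < 1" and T: "T > 0"
    and ex: "\<And>t. t > 0 \<Longrightarrow> caputo_dodson_exists \<beta> \<nu> g t"
    and eq: "\<And>t. t > 0 \<Longrightarrow> caputo_dodson \<beta> \<nu> g t = of_real c * g t"
    and lim: "(g \<longlongrightarrow> 0) (at_right 0)"
  shows "g T = 0"
proof -
  define s where "s = dodson_time \<beta>"
  obtain m where m: "\<And>t. 0 < t \<Longrightarrow> t \<le> T \<Longrightarrow> norm (g t) \<le> m"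
    using caputo_dodson_bounded[OF ex lim] by metis
  have G: "Gamma \<nu> > 0" using nu by (intro Gamma_real_pos)
  have bound: "norm (g t) \<le> m * (rGamma (1 + \<nu> * real n) * (\<bar>c\<bar> * s t powr \<nu>) ^ n)" if "0 < t" "t \<le> T" for n t
    using that
  proof (induction n arbitrary: t)
    case 0
    thus ?case using m by simp
  next
    case (Suc n)
    define q where "q = 1 + \<nu> * real n"
    have q: "q > 0" using nu by (auto simp: q_def intro: add_pos_nonneg)
    have spos: "s y > 0" if "y > 0" for y using dodson_time_pos[OF \<beta> that] by (simp add: s_def)
    have pw: "(s y powr \<nu>) ^ n = s y powr (q - 1)" if "y > 0" for y
      using spos[OF that] by (simp add: powr_realpow[symmetric] powr_powr q_def)
    define K where "K = \<bar>c\<bar> * m * rGamma q * \<bar>c\<bar> ^ n"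
    let ?f = "\<lambda>y. indicator {0<..<t} y *\<^sub>R (((s t - s y) powr (\<nu> - 1) * exp (- \<beta> * y)) *\<^sub>R g y)"
    let ?h = "\<lambda>y. K * (indicator {0<..<t} y *\<^sub>R ((s t - s y) powr (\<nu> - 1) * (s y - s 0) powr (q - 1) * exp (- \<beta> * y)))"
    have h: "has_bochner_integral lborel ?h (K * ((s t - s 0) powr (\<nu> + q - 1) * Beta \<nu> q))"
      unfolding s_def using Suc.prems nu q by (intro has_bochner_integral_mult_right has_bochner_integral_dodson_Beta \<beta>) auto
    have "Gamma \<nu> * norm (g t) = norm (LINT y|lborel. of_real c * ?f y)"
      unfolding s_def
      by (subst caputo_dodson_Volterra(2)[OF \<beta> nu Suc.prems(1) ex eq lim, symmetric]) (use G in \<open>auto simp: norm_mult\<close>)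
    also have "\<dots> \<le> (LINT y|lborel. ?h y)"
    proof (rule order_trans[OF Bochner_Integration.integral_norm_bound integral_mono])
      show "integrable lborel (\<lambda>y. norm (of_real c * ?f y))"
        unfolding s_def by (rule integrable_norm) (rule caputo_dodson_Volterra(1)[OF \<beta> nu Suc.prems(1) ex eq lim])
      show "integrable lborel ?h" using h by (rule integrable.intros)
      fix y
      show "norm (of_real c * ?f y) \<le> ?h y"
      proof (cases "y \<in> {0<..<t}")
        case True
        have "norm (g y) \<le> m * (rGamma q * (\<bar>c\<bar> ^ n * s y powr (q - 1)))"
          using Suc.IH[of y] Suc.prems True by (simp add: q_def[symmetric] power_mult_distrib pw)
        hence "\<bar>c\<bar> * ((s t - s y) powr (\<nu> - 1) * exp (- \<beta> * y)) * norm (g y) \<le>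
          \<bar>c\<bar> * ((s t - s y) powr (\<nu> - 1) * exp (- \<beta> * y)) * (m * (rGamma q * (\<bar>c\<bar> ^ n * s y powr (q - 1))))"
          by (intro mult_left_mono) auto
        thus ?thesis using True by (simp add: K_def norm_mult s_def mult_ac)
      qed auto
    qed
    also have "\<dots> = K * ((s t - s 0) powr (\<nu> + q - 1) * Beta \<nu> q)"
      by (rule has_bochner_integral_integral_eq[OF h])
    also have "s t - s 0 = s t" by (simp add: s_def)
    also have "s t powr (\<nu> + q - 1) = s t powr \<nu> * (s t powr \<nu>) ^ n"
      using powr_add[of "s t" \<nu> "q - 1"] pw[OF Suc.prems(1)] by (simp add: add_diff_eq)
    \<comment> \<open>\<open>Gamma q\<close> cancels the coefficient \<open>rGamma q\<close> of the
      induction hypothesis and \<open>Gamma \<nu>\<close> the factor on the left, which leaves the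
      next coefficient of the series.\<close>
    also have "Beta \<nu> q = Gamma \<nu> * Gamma q * rGamma (1 + \<nu> * real (Suc n))"
      by (simp add: Beta_altdef q_def algebra_simps)
    also have "K * (s t powr \<nu> * (s t powr \<nu>) ^ n * (Gamma \<nu> * Gamma q * rGamma (1 + \<nu> * real (Suc n)))) =
       Gamma \<nu> * (m * (rGamma (1 + \<nu> * real (Suc n)) * (\<bar>c\<bar> * s t powr \<nu>) ^ Suc n)) * (rGamma q * Gamma q)"
      by (simp add: K_def power_mult_distrib mult_ac)
    also have "rGamma q * Gamma q = 1" using rGamma_pos[OF q] by (simp add: Gamma_def)
    finally show ?case using G by (simp only: mult_1_right mult_le_cancel_left_pos)
  qed
  have "summable (\<lambda>n. rGamma (1 + \<nu> * real n) * (\<bar>c\<bar> * s T powr \<nu>) ^ n)"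
    by (rule summable_norm_cancel[OF summable_mittag_leffler[OF nu(1)]])
  hence "(\<lambda>n. m * (rGamma (1 + \<nu> * real n) * (\<bar>c\<bar> * s T powr \<nu>) ^ n)) \<longlonglongrightarrow> m * 0"
    by (intro tendsto_intros summable_LIMSEQ_zero)
  hence "norm (g T) \<le> m * 0"
    by (rule LIMSEQ_le_const) (use bound[OF T order_refl] in auto)
  thus ?thesis by simp
qed

text \<open>By linearity the difference solves the same equation with initial value 0; existence of
  both derivatives and integrals is what allows the operator to be split.\<close>

lemma caputo_dodson_unique:
  assumes \<beta>: "\<beta> > 0" and nu: "0 < \<nu>" "\<nu> < 1" and T: "T > 0"
    and g: "\<And>t. t > 0 \<Longrightarrow> caputo_dodson_exists \<beta> \<nu> g t"
      "\<And>t. t > 0 \<Longrightarrow> caputo_dodson \<beta> \<nu> g t = of_real c * g t" "(g \<longlongrightarrow> l) (at_right 0)"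
    and h: "\<And>t. t > 0 \<Longrightarrow> caputo_dodson_exists \<beta> \<nu> h t"
      "\<And>t. t > 0 \<Longrightarrow> caputo_dodson \<beta> \<nu> h t = of_real c * h t" "(h \<longlongrightarrow> l) (at_right 0)"
  shows "g T = h T"
proof -
  define d where "d = (\<lambda>t. g t - h t)"
  have diff: "g differentiable at \<tau>" "h differentiable at \<tau>" if "\<tau> > 0" for \<tau>
    using g(1)[of "\<tau> + 1"] h(1)[of "\<tau> + 1"] that unfolding caputo_dodson_exists_def by auto
  have int: "indicator {0<..<t} \<tau> *\<^sub>R caputo_dodson_integrand \<beta> \<nu> d t \<tau> =
     indicator {0<..<t} \<tau> *\<^sub>R caputo_dodson_integrand \<beta> \<nu> g t \<tau> - indicator {0<..<t} \<tau> *\<^sub>R caputo_dodson_integrand \<beta> \<nu> h t \<tau>" for t \<tau>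
  proof (cases "\<tau> \<in> {0<..<t}")
    case True
    thus ?thesis
      using vector_derivative_diff_at[OF diff[of \<tau>]]
      by (simp add: caputo_dodson_integrand_def d_def[abs_def] scaleR_diff_right)
  qed auto
  have "d T = 0"
  proof (rule caputo_dodson_eq_0[OF \<beta> nu T])
    show "caputo_dodson_exists \<beta> \<nu> d t" if "t > 0" for t
      using g(1)[OF that] h(1)[OF that]
      unfolding caputo_dodson_exists_def set_integrable_def int
      by (auto simp: d_def[abs_def] intro!: differentiable_diff)
    show "caputo_dodson \<beta> \<nu> d t = of_real c * d t" if "t > 0" for t
    proof -
      have "caputo_dodson \<beta> \<nu> d t = caputo_dodson \<beta> \<nu> g t - caputo_dodson \<beta> \<nu> h t"
        using g(1)[OF that] h(1)[OF that]
        by (simp add: caputo_dodson_def set_lebesgue_integral_def int caputo_dodson_exists_def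
            set_integrable_def diff_divide_distrib scaleR_diff_right)
      thus ?thesis using g(2)[OF that] h(2)[OF that] by (simp add: d_def algebra_simps)
    qed
    show "(d \<longlongrightarrow> 0) (at_right 0)"
      using tendsto_diff[OF g(3) h(3)] by (simp add: d_def[abs_def])
  qed
  thus ?thesis by (simp add: d_def)
qed

section \<open>Injectivity of the Fourier transform\<close>

text \<open>The positive and negative parts have equal transforms, hence, at \<open>k = 0\<close>,
  equal mass \<open>m\<close>. Divided by \<open>m\<close> they are probability densities with the
  same characteristic function.\<close>

lemma fourier_transform_zero_imp_AE_zero:
  fixes h :: "real \<Rightarrow> real"
  assumes h: "integrable lborel h"
    and F: "\<And>k. (LINT x|lborel. exp (\<i> * of_real k * of_real x) * of_real (h x)) = 0"
  shows "AE x in lborel. h x = 0"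
proof -
  define p where "p = (\<lambda>x. max 0 (h x))"
  define n where "n = (\<lambda>x. max 0 (- h x))"
  have hpn: "h x = p x - n x" for x by (simp add: p_def n_def max_def)
  have pn_nonneg: "p x \<ge> 0" "n x \<ge> 0" for x by (auto simp: p_def n_def)
  have pn: "integrable lborel p" "integrable lborel n"
    using h by (auto simp: p_def n_def intro!: integrable_max)
  hence [measurable]: "p \<in> borel_measurable borel" "n \<in> borel_measurable borel"
    by (auto dest: borel_measurable_integrable)
  define m where "m = integral\<^sup>L lborel p"
  have transf: "(LINT x|lborel. p x *\<^sub>R iexp (k * x)) = (LINT x|lborel. n x *\<^sub>R iexp (k * x))" for k
  proof -
    have int: "integrable lborel (\<lambda>x. q x *\<^sub>R iexp (k * x))" if "integrable lborel q" for q :: "real \<Rightarrow> real"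
      by (rule Bochner_Integration.integrable_bound[OF that]) (use that in \<open>auto dest: borel_measurable_integrable\<close>)
    have "(LINT x|lborel. p x *\<^sub>R iexp (k * x)) - (LINT x|lborel. n x *\<^sub>R iexp (k * x)) =
       (LINT x|lborel. p x *\<^sub>R iexp (k * x) - n x *\<^sub>R iexp (k * x))"
      by (rule Bochner_Integration.integral_diff[symmetric]) (intro int pn)+
    also have "\<dots> = (LINT x|lborel. exp (\<i> * of_real k * of_real x) * of_real (h x))"
      by (intro Bochner_Integration.integral_cong refl)
        (simp add: hpn scaleR_conv_of_real algebra_simps)
    finally show ?thesis using F[of k] by simp
  qed
  have m: "integral\<^sup>L lborel n = m"
  proof -
    have "complex_of_real (integral\<^sup>L lborel p) = of_real (integral\<^sup>L lborel n)"
      using transf[of 0] by (simp add: scaleR_conv_of_real)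
    thus ?thesis by (simp add: m_def)
  qed
  have "m \<ge> 0" unfolding m_def by (intro Bochner_Integration.integral_nonneg) (simp add: pn_nonneg)
  show ?thesis
  \<comment> \<open>With mass 0 no normalisation is possible, but then both nonnegative parts vanish
    almost everywhere.\<close>
  proof (cases "m = 0")
    case True
    have "AE x in lborel. p x = 0" "AE x in lborel. n x = 0"
      using integral_nonneg_eq_0_iff_AE[OF pn(1)] integral_nonneg_eq_0_iff_AE[OF pn(2)] True m pn_nonneg
      by (auto simp: m_def)
    thus ?thesis by eventually_elim (simp add: hpn)
  next
    case False
    with \<open>m \<ge> 0\<close> have mpos: "m > 0" by simp
    have dist: "real_distribution (density lborel (\<lambda>x. ennreal (q x / m)))"
      if q: "integrable lborel q" "\<And>x. q x \<ge> 0" "integral\<^sup>L lborel q = m" for q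
    proof -
      have [measurable]: "q \<in> borel_measurable borel" using q(1) by (auto dest: borel_measurable_integrable)
      have "(\<integral>\<^sup>+x. ennreal (q x / m) \<partial>lborel) = ennreal (LINT x|lborel. q x / m)"
        using q mpos by (intro nn_integral_eq_integral) auto
      also have "(LINT x|lborel. q x / m) = 1" using q(3) mpos by simp
      finally have "prob_space (density lborel (\<lambda>x. ennreal (q x / m)))"
        by (intro prob_spaceI) (simp add: emeasure_density)
      thus ?thesis by (simp add: real_distribution_def real_distribution_axioms_def)
    qed
    have ch: "char (density lborel (\<lambda>x. ennreal (q x / m))) k = (1 / m) *\<^sub>R (LINT x|lborel. q x *\<^sub>R iexp (k * x))"
      if q: "integrable lborel q" "\<And>x. q x \<ge> 0" for q k
    proof -
      have [measurable]: "q \<in> borel_measurable borel" using q(1) by (auto dest: borel_measurable_integrable)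
      have "char (density lborel (\<lambda>x. ennreal (q x / m))) k = (LINT x|lborel. (q x / m) *\<^sub>R iexp (k * x))"
        unfolding char_def using q(2) mpos by (intro integral_density) auto
      also have "\<dots> = (LINT x|lborel. (1 / m) *\<^sub>R (q x *\<^sub>R iexp (k * x)))"
        by (simp add: divide_inverse mult.commute)
      also have "\<dots> = (1 / m) *\<^sub>R (LINT x|lborel. q x *\<^sub>R iexp (k * x))"
        by (rule integral_scaleR_right)
      finally show ?thesis .
    qed
    have "density lborel (\<lambda>x. ennreal (p x / m)) = density lborel (\<lambda>x. ennreal (n x / m))"
    proof (rule Levy_uniqueness)
      show "char (density lborel (\<lambda>x. ennreal (p x / m))) = char (density lborel (\<lambda>x. ennreal (n x / m)))"
        using ch[OF pn(1)] ch[OF pn(2)] pn_nonneg transf by (simp add: fun_eq_iff)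
    qed (use dist[OF pn(1)] dist[OF pn(2)] pn_nonneg m in \<open>auto simp: m_def\<close>)
    hence "AE x in lborel. ennreal (p x / m) = ennreal (n x / m)"
      by (subst (asm) sigma_finite_measure.density_unique_iff[OF sigma_finite_lborel]) auto
    thus ?thesis
      by eventually_elim (use mpos pn_nonneg in \<open>simp add: hpn\<close>)
  qed
qed

section \<open>Existence and uniqueness of the fundamental solution\<close>

lemma mittag_leffler_at_0:
  assumes "\<nu> > 0"
  shows "mittag_leffler \<nu> 0 = 1" "isCont (mittag_leffler \<nu>) 0"
proof -
  show "mittag_leffler \<nu> 0 = 1" by (simp add: mittag_leffler_def)
  show "isCont (mittag_leffler \<nu>) 0" unfolding mittag_leffler_def[abs_def]
    by (intro isCont_powser_converges_everywhere summable_norm_cancel[OF summable_mittag_leffler[OF assms]])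
qed

theorem theorem3p1:
  fixes \<beta> \<nu> :: real
  assumes "\<beta> > 0" and "0 < \<nu>" and "\<nu> < 1"
  defines "c \<equiv> \<lambda>x t. 1 / 2 * wright_MM (\<nu> / 2) \<bar>x\<bar> ((1 - exp (- \<beta> * t)) / \<beta>)"
  shows "dodson_fundamental_solution \<beta> \<nu> c \<and>
         (\<forall>u. dodson_fundamental_solution \<beta> \<nu> u \<longrightarrow>
              (\<forall>t>0. AE x in lborel. u x t = c x t))"
proof -
  note \<beta> = assms(1) and nu = assms(2,3)
  have c: "c x t = 1 / 2 * wright_MM (\<nu> / 2) \<bar>x\<bar> (dodson_time \<beta> t)" for x t
    by (simp add: c_def dodson_time_def)
  have int: "integrable lborel (\<lambda>x. c x t)" if "t > 0" for t
    unfolding c by (rule integrable_wright_MM[OF nu dodson_time_pos[OF \<beta> that]])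
  have Fc: "fourier_x c k t = of_real (mittag_leffler \<nu> (- k\<^sup>2 * dodson_time \<beta> t powr \<nu>))" if "t > 0" for k t
    unfolding fourier_x_def c fourier_wright_MM[OF nu dodson_time_pos[OF \<beta> that]] by simp
  have sol: "dodson_fundamental_solution \<beta> \<nu> c"
    unfolding dodson_fundamental_solution_def
  proof (intro conjI allI impI)
    fix k t :: real assume t: "t > 0"
    show "caputo_dodson_exists \<beta> \<nu> (fourier_x c k) t"
      by (rule caputo_dodson_mittag_leffler(1)[OF \<beta> nu t Fc])
    show "caputo_dodson \<beta> \<nu> (fourier_x c k) t = - (complex_of_real k)\<^sup>2 * fourier_x c k t"
      using caputo_dodson_mittag_leffler(2)[OF \<beta> nu t Fc] by simp
  next
    fix k :: real
    \<comment> \<open>The base tends to 0, where continuity of the power needs a positive exponent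
      and a base that is eventually nonnegative.\<close>
    have "((\<lambda>t. dodson_time \<beta> t powr \<nu>) \<longlongrightarrow> 0 powr \<nu>) (at_right 0)"
    proof (rule tendsto_powr')
      show "(dodson_time \<beta> \<longlongrightarrow> 0) (at_right 0)"
        using DERIV_isCont[OF DERIV_dodson_time[OF \<beta>, of 0 UNIV]]
        by (auto simp: isCont_def intro: filterlim_mono[OF _ _ at_le])
      show "0 \<noteq> (0::real) \<or> 0 < \<nu> \<and> (\<forall>\<^sub>F t in at_right 0. 0 \<le> dodson_time \<beta> t)"
        using nu dodson_time_pos[OF \<beta>] by (auto simp: eventually_at_right_field intro!: exI[of _ 1] less_imp_le)
    qed simp
    hence "((\<lambda>t. - k\<^sup>2 * dodson_time \<beta> t powr \<nu>) \<longlongrightarrow> - k\<^sup>2 * 0) (at_right 0)"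
      using nu by (intro tendsto_intros) simp
    hence "((\<lambda>t. - k\<^sup>2 * dodson_time \<beta> t powr \<nu>) \<longlongrightarrow> 0) (at_right 0)" by simp
    hence "((\<lambda>t. mittag_leffler \<nu> (- k\<^sup>2 * dodson_time \<beta> t powr \<nu>)) \<longlongrightarrow> mittag_leffler \<nu> 0) (at_right 0)"
      by (rule isCont_tendsto_compose[OF mittag_leffler_at_0(2)[OF nu(1)]])
    hence "((\<lambda>t. complex_of_real (mittag_leffler \<nu> (- k\<^sup>2 * dodson_time \<beta> t powr \<nu>))) \<longlongrightarrow> of_real 1) (at_right 0)"
      unfolding mittag_leffler_at_0(1)[OF nu(1)] by (rule tendsto_of_real)
    thus "(fourier_x c k \<longlongrightarrow> 1) (at_right 0)"
    proof (rule filterlim_cong[THEN iffD1, rotated -1])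
      show "\<forall>\<^sub>F t in at_right 0. complex_of_real (mittag_leffler \<nu> (- k\<^sup>2 * dodson_time \<beta> t powr \<nu>)) = fourier_x c k t"
        using Fc by (auto simp: eventually_at_right_field intro!: exI[of _ 1])
    qed auto
  qed (rule int)
  moreover have "AE x in lborel. u x t = c x t"
    if u: "dodson_fundamental_solution \<beta> \<nu> u" and t: "t > 0" for u t
  proof -
    have uint: "integrable lborel (\<lambda>x. u x t)"
      using u t by (simp add: dodson_fundamental_solution_def)
    \<comment> \<open>For each frequency both transforms solve the Caputo equation with eigenvalue
      \<open>- k\<^sup>2\<close> and initial limit 1.\<close>
    have eq: "fourier_x u k t = fourier_x c k t" for k
      by (rule caputo_dodson_unique[OF \<beta> nu t, where c = "- k\<^sup>2" and l = 1])
        (use u sol in \<open>auto simp: dodson_fundamental_solution_def\<close>)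
    have intk: "integrable lborel (\<lambda>x. exp (\<i> * of_real k * of_real x) * complex_of_real (v x))"
      if "integrable lborel v" for v k
      by (rule Bochner_Integration.integrable_bound[OF that]) (use that in \<open>auto simp: norm_mult dest: borel_measurable_integrable\<close>)
    \<comment> \<open>The transform does not see null sets, so equality can be asserted only almost
      everywhere in \<open>x\<close>.\<close>
    have "AE x in lborel. u x t - c x t = 0"
    proof (rule fourier_transform_zero_imp_AE_zero)
      show "integrable lborel (\<lambda>x. u x t - c x t)"
        by (intro Bochner_Integration.integrable_diff uint int t)
      fix k
      have "(LINT x|lborel. exp (\<i> * of_real k * of_real x) * complex_of_real (u x t - c x t)) = fourier_x u k t - fourier_x c k t"
        unfolding fourier_x_def of_real_diff right_diff_distrib
        by (rule Bochner_Integration.integral_diff) (intro intk uint int t)+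
      thus "(LINT x|lborel. exp (\<i> * of_real k * of_real x) * complex_of_real (u x t - c x t)) = 0"
        by (simp add: eq)
    qed
    thus ?thesis by eventually_elim simp
  qed
  ultimately show ?thesis by blast
qed

end
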